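(* Let $n$ be an integer with $n=3$ or $n\geq 5$. If $G$ is a non-cyclic quotient of the braid group $B_n$, then either $|G|>|S_n|=n!$, or $G$ is isomorphic to the symmetric group $S_n$. Moreover, in the latter case the quotient map $B_n\to G$ is obtained by postcomposing the natural map $\pi:B_n\to S_n$ with an automorphism of $S_n$ (after identifying $G$ with $S_n$).
   Context: $B_n$ is the Artin braid group on $n$ strands, with presentation $\langle \sigma_1,\dots,\sigma_{n-1}\mid \sigma_i\sigma_{i+1}\sigma_i=\sigma_{i+1}\sigma_i\sigma_{i+1}\ (1\le i<n-1),\ \sigma_i\sigma_j=\sigma_j\sigma_i\ (|i-j|>1)\rangle$. $S_n$ is the symmetric group on $n$ letters. The natural map $\pi:B_n\to S_n$ is the epimorphism obtained by adding the relations $\sigma_i^2=1$, i.e. $\sigma_i\mapsto (i,i+1)$. A non-cyclic quotient is a surjective image of the group that is not a cyclic group (the trivial group is cyclic); quotients may be infinite. *)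

theory Defs
  imports "HOL-Algebra.Elementary_Groups" "HOL-Algebra.Sym_Groups"
begin

section \<open>Groups given by a presentation\<close>

text \<open>A letter \<open>(x, True)\<close> stands for the generator \<open>x\<close>, and \<open>(x, False)\<close> for its formal inverse.
  A relation \<open>u = v\<close> between words is the pair \<open>(u, v)\<close>.\<close>

type_synonym 'x word = "('x \<times> bool) list"

definition words :: "'x set \<Rightarrow> 'x word set" where
  "words S = lists (S \<times> UNIV)"

inductive word_equiv :: "'x set \<Rightarrow> ('x word \<times> 'x word) set \<Rightarrow> 'x word \<Rightarrow> 'x word \<Rightarrow> bool"
  for S :: "'x set" and R :: "('x word \<times> 'x word) set" where
  refl: "w \<in> words S \<Longrightarrow> word_equiv S R w w"
| sym: "word_equiv S R u v \<Longrightarrow> word_equiv S R v u"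
| trans: "word_equiv S R u v \<Longrightarrow> word_equiv S R v w \<Longrightarrow> word_equiv S R u w"
| append: "word_equiv S R u u' \<Longrightarrow> word_equiv S R v v' \<Longrightarrow> word_equiv S R (u @ v) (u' @ v')"
| cancel: "x \<in> S \<Longrightarrow> word_equiv S R [(x, b), (x, \<not> b)] []"
| relation: "(u, v) \<in> R \<Longrightarrow> u \<in> words S \<Longrightarrow> v \<in> words S \<Longrightarrow> word_equiv S R u v"

definition word_class :: "'x set \<Rightarrow> ('x word \<times> 'x word) set \<Rightarrow> 'x word \<Rightarrow> 'x word set" where
  "word_class S R w = {v. word_equiv S R w v}"

definition presented_group :: "'x set \<Rightarrow> ('x word \<times> 'x word) set \<Rightarrow> 'x word set monoid" where
  "presented_group S R =
     \<lparr> carrier = word_class S R ` words S,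
       monoid.mult = (\<lambda>A B. \<Union>u\<in>A. \<Union>v\<in>B. word_class S R (u @ v)),
       monoid.one = word_class S R [] \<rparr>"

definition word_eval :: "('g, 'm) monoid_scheme \<Rightarrow> ('x \<Rightarrow> 'g) \<Rightarrow> 'x word \<Rightarrow> 'g" where
  "word_eval G f w =
     foldr (\<lambda>(x, b) g. (if b then f x else inv\<^bsub>G\<^esub> (f x)) \<otimes>\<^bsub>G\<^esub> g) w \<one>\<^bsub>G\<^esub>"

text \<open>The map out of a presented group determined by the images \<open>f x\<close> of the generators.  It is
  meaningful only if \<open>f\<close> respects the relations, so that all words of a class have the same value;
  see \<open>presented_lift_hom\<close> below.\<close>

definition presented_lift ::
  "('g, 'm) monoid_scheme \<Rightarrow> ('x \<Rightarrow> 'g) \<Rightarrow> 'x word set \<Rightarrow> 'g" where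
  "presented_lift G f A = the_elem (word_eval G f ` A)"

lemma words_Nil [simp]: "[] \<in> words S"
  by (simp add: words_def)

lemma words_Cons [simp]: "p # w \<in> words S \<longleftrightarrow> fst p \<in> S \<and> w \<in> words S"
  by (cases p) (auto simp: words_def)

lemma words_append [simp]: "u @ v \<in> words S \<longleftrightarrow> u \<in> words S \<and> v \<in> words S"
  by (auto simp: words_def)

lemma word_equiv_words: "word_equiv S R u v \<Longrightarrow> u \<in> words S \<and> v \<in> words S"
  by (induction rule: word_equiv.induct) auto

lemma word_class_eq_iff:
  assumes "u \<in> words S"
  shows "word_class S R u = word_class S R v \<longleftrightarrow> word_equiv S R u v"
proof
  assume "word_class S R u = word_class S R v"
  moreover have "u \<in> word_class S R u"
    using assms by (simp add: word_class_def word_equiv.refl)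
  ultimately show "word_equiv S R u v"
    by (simp add: word_class_def word_equiv.sym)
next
  assume "word_equiv S R u v"
  then show "word_class S R u = word_class S R v"
    unfolding word_class_def by (blast intro: word_equiv.sym word_equiv.trans)
qed

lemma word_class_mult:
  assumes "u \<in> words S" "v \<in> words S"
  shows "word_class S R u \<otimes>\<^bsub>presented_group S R\<^esub> word_class S R v = word_class S R (u @ v)"
proof -
  have "word_class S R (u' @ v') = word_class S R (u @ v)"
    if "word_equiv S R u u'" "word_equiv S R v v'" for u' v'
  proof -
    have "word_equiv S R (u @ v) (u' @ v')"
      using that by (rule word_equiv.append)
    then show ?thesis
      using assms word_class_eq_iff[of "u @ v" S R "u' @ v'"] by simp
  qed
  moreover have "u \<in> word_class S R u" "v \<in> word_class S R v"
    using assms by (simp_all add: word_class_def word_equiv.refl)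
  ultimately have "(\<Union>u'\<in>word_class S R u. \<Union>v'\<in>word_class S R v. word_class S R (u' @ v'))
      = word_class S R (u @ v)"
    unfolding word_class_def[of S R u] word_class_def[of S R v] by blast
  then show ?thesis
    by (simp add: presented_group_def)
qed

lemma word_class_in_carrier:
  "w \<in> words S \<Longrightarrow> word_class S R w \<in> carrier (presented_group S R)"
  by (simp add: presented_group_def)

lemma word_inverse_exists:
  "w \<in> words S \<Longrightarrow> \<exists>v \<in> words S. word_equiv S R (v @ w) []"
proof (induction w)
  case Nil
  then show ?case
    by (auto intro!: bexI[of _ "[]"] word_equiv.refl)
next
  case (Cons p w)
  obtain x b where p: "p = (x, b)" by (cases p)
  from Cons p have x: "x \<in> S" and w: "w \<in> words S" by auto
  from Cons.IH[OF w] obtain v where v: "v \<in> words S" "word_equiv S R (v @ w) []" by auto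
  have "word_equiv S R ([(x, \<not> b), (x, \<not> \<not> b)] @ w) ([] @ w)"
    by (intro word_equiv.append word_equiv.cancel word_equiv.refl x w)
  then have "word_equiv S R (v @ ([(x, \<not> b), (x, b)] @ w)) (v @ w)"
    using v(1) word_equiv.append[OF word_equiv.refl] by simp
  then have "word_equiv S R ((v @ [(x, \<not> b)]) @ p # w) []"
    using v(2) p by (auto intro: word_equiv.trans)
  moreover have "v @ [(x, \<not> b)] \<in> words S"
    using v x by simp
  ultimately show ?case by blast
qed

lemma group_presented_group: "group (presented_group S R)"
proof (rule groupI)
  let ?P = "presented_group S R"
  have carr: "\<exists>w \<in> words S. A = word_class S R w" if "A \<in> carrier ?P" for A
    using that by (auto simp: presented_group_def)
  have one: "\<one>\<^bsub>?P\<^esub> = word_class S R []"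
    by (simp add: presented_group_def)
  show "\<one>\<^bsub>?P\<^esub> \<in> carrier ?P"
    by (simp add: one word_class_in_carrier)
  fix A B C
  assume A: "A \<in> carrier ?P"
  then obtain u where u: "u \<in> words S" "A = word_class S R u" using carr by blast
  show "\<one>\<^bsub>?P\<^esub> \<otimes>\<^bsub>?P\<^esub> A = A"
    using u by (simp add: one word_class_mult)
  from word_inverse_exists[OF u(1)] obtain v
    where v: "v \<in> words S" "word_equiv S R (v @ u) []" by blast
  then have "word_class S R (v @ u) = word_class S R []"
    using u by (simp add: word_class_eq_iff)
  then have "word_class S R v \<otimes>\<^bsub>?P\<^esub> A = \<one>\<^bsub>?P\<^esub>"
    using u v by (simp add: one word_class_mult)
  with word_class_in_carrier[OF v(1)] show "\<exists>D \<in> carrier ?P. D \<otimes>\<^bsub>?P\<^esub> A = \<one>\<^bsub>?P\<^esub>"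
    by (rule bexI[rotated])
  assume B: "B \<in> carrier ?P"
  then obtain v where v: "v \<in> words S" "B = word_class S R v" using carr by blast
  show "A \<otimes>\<^bsub>?P\<^esub> B \<in> carrier ?P"
    using u v by (simp add: word_class_mult word_class_in_carrier)
  assume "C \<in> carrier ?P"
  then obtain w where w: "w \<in> words S" "C = word_class S R w" using carr by blast
  show "A \<otimes>\<^bsub>?P\<^esub> B \<otimes>\<^bsub>?P\<^esub> C = A \<otimes>\<^bsub>?P\<^esub> (B \<otimes>\<^bsub>?P\<^esub> C)"
    using u v w by (simp add: word_class_mult)
qed

context group
begin

lemma word_eval_closed:
  "f \<in> S \<rightarrow> carrier G \<Longrightarrow> w \<in> words S \<Longrightarrow> word_eval G f w \<in> carrier G"
  by (induction w) (auto simp: word_eval_def dest: funcset_mem)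

lemma word_eval_append:
  assumes "f \<in> S \<rightarrow> carrier G" "u \<in> words S" "v \<in> words S"
  shows "word_eval G f (u @ v) = word_eval G f u \<otimes> word_eval G f v"
  using assms(2)
proof (induction u)
  case Nil
  then show ?case
    using word_eval_closed[OF assms(1,3)] by (simp add: word_eval_def)
next
  case (Cons p u)
  obtain x b where p: "p = (x, b)" by (cases p)
  have step: "word_eval G f (p # w) = (if b then f x else inv (f x)) \<otimes> word_eval G f w" for w
    by (simp add: word_eval_def p)
  have "f x \<in> carrier G" "u \<in> words S"
    using Cons.prems assms(1) p by auto
  then show ?case
    using Cons.IH word_eval_closed[OF assms(1)] assms(3)
    by (simp add: step m_assoc)
qed

lemma word_eval_equiv:
  assumes f: "f \<in> S \<rightarrow> carrier G"
    and R: "\<And>u v. (u, v) \<in> R \<Longrightarrow> u \<in> words S \<Longrightarrow> v \<in> words S \<Longrightarrow> word_eval G f u = word_eval G f v"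
    and "word_equiv S R u v"
  shows "word_eval G f u = word_eval G f v"
  using assms(3)
proof (induction rule: word_equiv.induct)
  case (append u u' v v')
  then show ?case
    using f word_equiv_words by (metis word_eval_append)
next
  case (cancel x b)
  then have "f x \<in> carrier G" using f by auto
  then show ?case by (simp add: word_eval_def)
qed (auto simp: R)

lemma presented_lift_word_class:
  assumes f: "f \<in> S \<rightarrow> carrier G"
    and R: "\<And>u v. (u, v) \<in> R \<Longrightarrow> u \<in> words S \<Longrightarrow> v \<in> words S \<Longrightarrow> word_eval G f u = word_eval G f v"
    and w: "w \<in> words S"
  shows "presented_lift G f (word_class S R w) = word_eval G f w"
proof -
  have "word_eval G f ` word_class S R w = {word_eval G f w}"
    using word_eval_equiv[OF f R] w
    by (auto simp: word_class_def image_iff intro!: exI[of _ w] word_equiv.refl)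
  then show ?thesis by (simp add: presented_lift_def)
qed

lemma presented_lift_hom:
  assumes f: "f \<in> S \<rightarrow> carrier G"
    and R: "\<And>u v. (u, v) \<in> R \<Longrightarrow> u \<in> words S \<Longrightarrow> v \<in> words S \<Longrightarrow> word_eval G f u = word_eval G f v"
  shows "presented_lift G f \<in> hom (presented_group S R) G"
proof (rule homI)
  note L = presented_lift_word_class[OF f R]
  fix A B
  assume "A \<in> carrier (presented_group S R)"
  then obtain u where u: "u \<in> words S" "A = word_class S R u"
    by (auto simp: presented_group_def)
  then show "presented_lift G f A \<in> carrier G"
    by (simp add: L word_eval_closed[OF f])
  assume "B \<in> carrier (presented_group S R)"
  then obtain v where v: "v \<in> words S" "B = word_class S R v"
    by (auto simp: presented_group_def)
  show "presented_lift G f (A \<otimes>\<^bsub>presented_group S R\<^esub> B)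
      = presented_lift G f A \<otimes> presented_lift G f B"
    using u v by (simp add: word_class_mult L word_eval_append[OF f])
qed

end


section \<open>Braid groups\<close>

definition braid_relations :: "nat \<Rightarrow> (nat word \<times> nat word) set" where
  "braid_relations n =
     {([(i, True), (i + 1, True), (i, True)], [(i + 1, True), (i, True), (i + 1, True)]) | i.
        1 \<le> i \<and> i < n - 1} \<union>
     {([(i, True), (j, True)], [(j, True), (i, True)]) | i j.
        i \<in> {1..<n} \<and> j \<in> {1..<n} \<and> \<bar>int i - int j\<bar> > 1}"

definition braid_group :: "nat \<Rightarrow> nat word set monoid" where
  "braid_group n = presented_group {1..<n} (braid_relations n)"

definition braid_gen :: "nat \<Rightarrow> nat \<Rightarrow> nat word set" where
  "braid_gen n i = word_class {1..<n} (braid_relations n) [(i, True)]"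

definition braid_to_sym :: "nat \<Rightarrow> nat word set \<Rightarrow> (nat \<Rightarrow> nat)" where
  "braid_to_sym n = presented_lift (sym_group n) (\<lambda>i. transpose i (i + 1))"

lemma group_braid_group: "group (braid_group n)"
  by (simp add: braid_group_def group_presented_group)

lemma transpose_in_sym_group:
  "(\<lambda>i. transpose i (i + 1)) \<in> {1..<n} \<rightarrow> carrier (sym_group n)"
  by (auto simp: sym_group_carrier intro!: permutes_swap_id)

lemma braid_relations_transpose:
  assumes "(u, v) \<in> braid_relations n"
  shows "word_eval (sym_group n) (\<lambda>i. transpose i (i + 1)) u =
         word_eval (sym_group n) (\<lambda>i. transpose i (i + 1)) v"
proof -
  consider
    (braid) i where "u = [(i, True), (i + 1, True), (i, True)]"
      "v = [(i + 1, True), (i, True), (i + 1, True)]"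
  | (comm) i j where "u = [(i, True), (j, True)]" "v = [(j, True), (i, True)]"
      "\<bar>int i - int j\<bar> > 1"
    using assms unfolding braid_relations_def by blast
  then show ?thesis
  proof cases
    case braid
    then show ?thesis
      by (simp add: word_eval_def sym_group_mult sym_group_one fun_eq_iff transpose_def)
  next
    case comm
    then have "i \<noteq> j" "i + 1 \<noteq> j" "j + 1 \<noteq> i" by auto
    then show ?thesis
      using comm by (simp add: word_eval_def sym_group_mult sym_group_one fun_eq_iff transpose_def)
  qed
qed

lemma braid_to_sym_hom: "braid_to_sym n \<in> hom (braid_group n) (sym_group n)"
  unfolding braid_to_sym_def braid_group_def
  by (intro group.presented_lift_hom sym_group_is_group transpose_in_sym_group
      braid_relations_transpose)

lemma braid_to_sym_gen:
  assumes "i \<in> {1..<n}"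
  shows "braid_to_sym n (braid_gen n i) = transpose i (i + 1)"
proof -
  have "braid_to_sym n (braid_gen n i) = word_eval (sym_group n) (\<lambda>i. transpose i (i + 1)) [(i, True)]"
    unfolding braid_to_sym_def braid_gen_def using assms
    by (intro group.presented_lift_word_class sym_group_is_group transpose_in_sym_group
        braid_relations_transpose) auto
  then show ?thesis
    by (simp add: word_eval_def sym_group_mult sym_group_one)
qed

end

theory Submission
  imports Defs
begin

text \<open>Let \<open>s\<^sub>1, \<dots>, s\<^bsub>n-1\<^esub>\<close> be the images of the standard generators in \<open>G\<close> and \<open>k = \<lfloor>n/2\<rfloor>\<close>. Since \<open>G\<close> is not
  cyclic, adjacent generators differ, so they do not commute. Which \<open>s\<^sub>t\<close> commute with a band generator
  \<open>a\<^sub>i\<^sub>j\<close> determines the pair \<open>{i, j}\<close> when \<open>n = 3\<close> or \<open>n \<ge> 5\<close>, so the band generators stay distinct in \<open>G\<close>.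
  Applying the orbit-stabilizer bound for conjugation successively to \<open>s\<^sub>1, s\<^sub>3, s\<^sub>5, \<dots>\<close> yields
  \<open>2\<^sup>k |G| \<ge> n! |A|\<close> with \<open>A = \<langle>s\<^sub>1, s\<^sub>3, \<dots>\<rangle>\<close> abelian. Adjoining each new generator of \<open>A\<close> at least doubles
  its order, so \<open>|A| \<ge> 2\<^bsup>k-1\<^esup> ord s\<^sub>1\<close>. Hence \<open>|G| \<ge> n!\<close>, and \<open>|G| \<le> n!\<close> forces \<open>s\<^sub>i\<^sup>2 = 1\<close>, in which case \<open>G\<close>
  is a quotient of the symmetric group by its Coxeter presentation.\<close>

section \<open>Conjugation, commutation and the braid relation\<close>


context group
begin

definition conjugate :: "'a \<Rightarrow> 'a \<Rightarrow> 'a" where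
  "conjugate g x = g \<otimes> x \<otimes> inv g"

text \<open>Distinctness is built in because every element satisfies the braid relation with itself;
  for distinct elements of the group the relation rules out commuting.\<close>

definition braided :: "'a \<Rightarrow> 'a \<Rightarrow> bool" where
  "braided x y \<longleftrightarrow> x \<noteq> y \<and> x \<otimes> y \<otimes> x = y \<otimes> x \<otimes> y"

definition commutes :: "'a \<Rightarrow> 'a \<Rightarrow> bool" where
  "commutes x y \<longleftrightarrow> x \<otimes> y = y \<otimes> x"

lemma conjugate_closed [simp]: "g \<in> carrier G \<Longrightarrow> x \<in> carrier G \<Longrightarrow> conjugate g x \<in> carrier G"
  by (simp add: conjugate_def)

lemma conjugate_one [simp]: "x \<in> carrier G \<Longrightarrow> conjugate \<one> x = x"
  by (simp add: conjugate_def)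

lemma conjugate_eq_iff:
  assumes "g \<in> carrier G" "x \<in> carrier G" "y \<in> carrier G"
  shows "conjugate g x = y \<longleftrightarrow> g \<otimes> x = y \<otimes> g"
  using assms inv_solve_right'[of y "g \<otimes> x" g] by (auto simp: conjugate_def)

lemma conjugate_inject [simp]:
  assumes "g \<in> carrier G" "x \<in> carrier G" "y \<in> carrier G"
  shows "conjugate g x = conjugate g y \<longleftrightarrow> x = y"
  using assms by (simp add: conjugate_def)

lemma conjugate_mult:
  assumes "g \<in> carrier G" "x \<in> carrier G" "y \<in> carrier G"
  shows "conjugate g (x \<otimes> y) = conjugate g x \<otimes> conjugate g y"
  using assms by (simp add: conjugate_def m_assoc inv_solve_left)

lemma conjugate_conjugate:
  assumes "g \<in> carrier G" "h \<in> carrier G" "x \<in> carrier G"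
  shows "conjugate g (conjugate h x) = conjugate (g \<otimes> h) x"
  using assms by (simp add: conjugate_def m_assoc inv_mult_group)

lemma conjugate_hom: "g \<in> carrier G \<Longrightarrow> conjugate g \<in> hom G G"
  by (auto intro!: homI simp: conjugate_mult)

lemma conjugate_int_pow:
  "g \<in> carrier G \<Longrightarrow> x \<in> carrier G \<Longrightarrow> conjugate g (x [^] (k::int)) = conjugate g x [^] k"
  using hom_int_pow[OF conjugate_hom] is_group by auto

lemma commutes_sym: "commutes x y \<longleftrightarrow> commutes y x"
  by (auto simp: commutes_def)

lemma braided_sym: "braided x y \<longleftrightarrow> braided y x"
  by (auto simp: braided_def)

lemma commutes_conjugate [simp]:
  assumes "g \<in> carrier G" "x \<in> carrier G" "y \<in> carrier G"
  shows "commutes (conjugate g x) (conjugate g y) \<longleftrightarrow> commutes x y"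
  using assms by (simp add: commutes_def flip: conjugate_mult)

lemma braided_conjugate [simp]:
  assumes "g \<in> carrier G" "x \<in> carrier G" "y \<in> carrier G"
  shows "braided (conjugate g x) (conjugate g y) \<longleftrightarrow> braided x y"
  using assms by (simp add: braided_def flip: conjugate_mult)

lemma conjugate_fix_iff:
  "g \<in> carrier G \<Longrightarrow> x \<in> carrier G \<Longrightarrow> conjugate g x = x \<longleftrightarrow> commutes g x"
  by (simp add: conjugate_eq_iff commutes_def)

lemma commutes_mult:
  assumes "x \<in> carrier G" "y \<in> carrier G" "z \<in> carrier G" "commutes x z" "commutes y z"
  shows "commutes (x \<otimes> y) z"
  using assms unfolding commutes_def by (metis m_assoc)

lemma commutes_inv:
  assumes "x \<in> carrier G" "y \<in> carrier G" "commutes x y"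
  shows "commutes (inv x) y"
proof -
  have "conjugate x y = y"
    using assms by (simp add: conjugate_fix_iff)
  moreover have "conjugate (inv x) (conjugate x y) = y"
    using assms(1,2) by (simp add: conjugate_conjugate)
  ultimately show ?thesis
    using assms(1,2) conjugate_fix_iff[of "inv x" y] by simp
qed

lemma commutes_int_pow:
  assumes "x \<in> carrier G" "y \<in> carrier G" "commutes x y"
  shows "commutes (x [^] (k::int)) y"
proof -
  have "conjugate y (x [^] k) = x [^] k"
    using assms by (metis conjugate_fix_iff conjugate_int_pow commutes_sym)
  then show ?thesis
    using assms by (metis conjugate_fix_iff commutes_sym int_pow_closed)
qed

lemma commutes_self [simp]: "commutes x x"
  by (simp add: commutes_def)

lemma commutes_one [simp]: "x \<in> carrier G \<Longrightarrow> commutes \<one> x"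
  by (simp add: commutes_def)

lemma commutes_generate:
  assumes "S \<subseteq> carrier G" "z \<in> carrier G" "\<And>x. x \<in> S \<Longrightarrow> commutes x z" "x \<in> generate G S"
  shows "commutes x z"
  using assms(4)
proof (induction rule: generate.induct)
  case (eng x y)
  then show ?case using assms(1,2) generate_in_carrier by (auto intro!: commutes_mult)
qed (use assms in \<open>auto intro!: commutes_inv\<close>)

section \<open>Consequences of the braid relation\<close>

lemma braided_imp_eq_if_commutes:
  assumes "x \<in> carrier G" "y \<in> carrier G" "x \<otimes> y \<otimes> x = y \<otimes> x \<otimes> y" "commutes x y"
  shows "x = y"
proof -
  have "x \<otimes> y \<otimes> x = x \<otimes> y \<otimes> y"
    using assms(3,4) by (metis commutes_def)
  then show ?thesis using assms(1,2) by simp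
qed

lemma braided_not_commutes:
  "x \<in> carrier G \<Longrightarrow> y \<in> carrier G \<Longrightarrow> braided x y \<Longrightarrow> \<not> commutes x y"
  using braided_imp_eq_if_commutes unfolding braided_def by blast

text \<open>The braid relation reads
  \<open>(x \<otimes> y) \<otimes> x = y \<otimes> (x \<otimes> y)\<close>.\<close>

lemma braided_conjugate_mult:
  assumes "x \<in> carrier G" "y \<in> carrier G" "braided x y"
  shows "conjugate (x \<otimes> y) x = y"
  using assms by (simp add: conjugate_eq_iff braided_def m_assoc)

lemma braided_conjugate_inv:
  assumes "x \<in> carrier G" "y \<in> carrier G" "braided x y"
  shows "conjugate x y = conjugate (inv y) x"
proof -
  have "conjugate y (conjugate x y) = x"
    using assms braided_conjugate_mult[of y x] by (simp add: conjugate_conjugate braided_sym)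
  then have "conjugate (inv y) x = conjugate (inv y) (conjugate y (conjugate x y))" by simp
  also have "\<dots> = conjugate x y"
    using assms by (simp add: conjugate_conjugate flip: m_assoc)
  finally show ?thesis ..
qed

text \<open>As \<open>x \<otimes> inv y\<close> fixes \<open>t\<close>, conjugation by
  \<open>inv x\<close> and by \<open>inv y\<close> sends \<open>t\<close> to the same element. By
  the braid relation these images are also the conjugates of \<open>x\<close> and \<open>y\<close>
  by \<open>t\<close>, and conjugation is injective.\<close>

lemma braided_eq_if_quotient_commutes:
  assumes c: "x \<in> carrier G" "y \<in> carrier G" "t \<in> carrier G"
    and x: "braided x t" and y: "braided y t" and xy: "commutes (x \<otimes> inv y) t"
  shows "x = y"
proof -
  have "conjugate (inv x) t = conjugate (inv x) (conjugate (x \<otimes> inv y) t)"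
    using c xy by (simp add: conjugate_fix_iff[THEN iffD2])
  also have "\<dots> = conjugate (inv y) t"
    using c by (simp add: conjugate_conjugate flip: m_assoc)
  finally have "conjugate t x = conjugate t y"
    using c x y braided_conjugate_inv[of t] by (simp add: braided_sym)
  then show ?thesis using c by simp
qed

text \<open>The common power commutes with \<open>r\<close> because \<open>p\<close> does, and it
  commutes with \<open>y\<close>, so conjugation by \<open>y \<otimes> r\<close> fixes it. That
  conjugation also carries \<open>y\<close> to \<open>r\<close>; hence
  \<open>y [^] m = r [^] m\<close>, which commutes with \<open>t\<close>.\<close>

lemma commutes_if_braided_power:
  assumes c: "p \<in> carrier G" "r \<in> carrier G" "t \<in> carrier G" "y \<in> carrier G"
    and pr: "commutes p r" and yr: "braided y r" and rt: "commutes r t"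
    and pow: "p [^] (m::int) = y [^] m"
  shows "commutes (y [^] m) t"
proof -
  have "commutes (y [^] m) r"
    using c pr pow commutes_int_pow by metis
  then have "conjugate y (conjugate r (y [^] m)) = y [^] m"
    using c by (metis commutes_self commutes_int_pow commutes_sym conjugate_fix_iff int_pow_closed)
  moreover have "conjugate (y \<otimes> r) (y [^] m) = r [^] m"
    using c yr by (simp add: conjugate_int_pow braided_conjugate_mult)
  ultimately have "r [^] m = y [^] m"
    using c by (simp add: conjugate_conjugate)
  then show ?thesis
    using c rt commutes_int_pow by metis
qed

text \<open>If \<open>p y\<close> commuted with \<open>t\<close>, the conjugate \<open>b\<close> of \<open>y\<close> by \<open>p t\<close> would satisfy \<open>t b = p y\<close>;
  then \<open>b y\<^sup>-\<^sup>1 = t\<^sup>-\<^sup>1 p\<close> commutes with \<open>r\<close>, which is braided with both \<open>b\<close> and \<open>y\<close>, forcing \<open>b = y\<close>.\<close>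

lemma not_commutes_mult_braided:
  assumes c: "p \<in> carrier G" "r \<in> carrier G" "t \<in> carrier G" "y \<in> carrier G"
    and pt: "braided p t" and py: "commutes p y" and pr: "commutes p r"
    and ty: "braided t y" and tr: "commutes t r" and yr: "braided y r"
  shows "\<not> commutes (p \<otimes> y) t"
proof
  assume *: "commutes (p \<otimes> y) t"
  define b where "b = conjugate (p \<otimes> t) y"
  have b: "b \<in> carrier G" using c by (simp add: b_def)
  have "commutes (p \<otimes> t) r" 
    using c pr tr by (intro commutes_mult)
  then have br: "braided b r"
    using c yr unfolding b_def by (metis braided_conjugate conjugate_fix_iff m_closed)
  \<comment> \<open>Conjugation by \<open>t\<close> fixes \<open>p \<otimes> y\<close> and turns
    \<open>p\<close> into \<open>conjugate (inv p) t\<close>; a further conjugation by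
    \<open>p\<close>, which also fixes \<open>p \<otimes> y\<close>, produces
    \<open>t \<otimes> b\<close>.\<close>
  have "t \<otimes> b = p \<otimes> y"
  proof -
    have "p \<otimes> y = conjugate t (p \<otimes> y)"
      using c * by (metis commutes_sym conjugate_fix_iff m_closed)
    also have "\<dots> = conjugate (inv p) t \<otimes> conjugate t y"
      using c pt braided_conjugate_inv[of t p] by (simp add: conjugate_mult braided_sym)
    finally have "conjugate p (p \<otimes> y) = conjugate p (conjugate (inv p) t \<otimes> conjugate t y)" by simp
    moreover have "conjugate p (p \<otimes> y) = p \<otimes> y"
      using c py by (simp add: conjugate_mult conjugate_fix_iff[THEN iffD2])
    ultimately show ?thesis
      using c by (simp add: conjugate_mult conjugate_conjugate b_def)
  qed
  then have "b = inv t \<otimes> (p \<otimes> y)"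
    using b c by (simp add: inv_solve_left)
  then have "b \<otimes> inv y = inv t \<otimes> p"
    using b c by (simp add: m_assoc)
  moreover have "commutes (inv t \<otimes> p) r"
    using c tr pr by (intro commutes_mult commutes_inv) auto
  ultimately have "b = y"
    using braided_eq_if_quotient_commutes[OF b c(4,2) br yr] by simp
  with \<open>t \<otimes> b = p \<otimes> y\<close> have "t \<otimes> y = p \<otimes> y" by simp
  then have "t = p" using c by simp
  then show False using pt by (simp add: braided_def)
qed

text \<open>Swapping \<open>p\<close> and \<open>y\<close> by conjugation turns \<open>p = v y\<^sup>e\<close> into \<open>y = v p\<^sup>e\<close>, hence \<open>p\<close> and \<open>y\<close> have the
  same power with exponent \<open>1 + e\<close>, and \<open>p y = v y\<^sup>1\<^sup>+\<^sup>e\<close> commutes with \<open>t\<close>.\<close>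

lemma power_relation_impossible:
  assumes c: "p \<in> carrier G" "r \<in> carrier G" "t \<in> carrier G" "y \<in> carrier G" "v \<in> carrier G"
    and pt: "braided p t" and py: "commutes p y" and pr: "commutes p r"
    and ty: "braided t y" and tr: "commutes t r" and yr: "braided y r"
    and v: "commutes v p" "commutes v t" "commutes v y"
  shows "p \<noteq> v \<otimes> y [^] (e::int)"
proof
  assume p: "p = v \<otimes> y [^] e"
  \<comment> \<open>Conjugation by \<open>p \<otimes> t\<close> and then by
    \<open>t \<otimes> y\<close> moves \<open>p\<close> to \<open>t\<close> to \<open>y\<close>.
    Since \<open>p\<close> and \<open>y\<close> commute, \<open>g\<close> also factors as
    \<open>t \<otimes> p \<otimes> (y \<otimes> t)\<close>, which moves \<open>y\<close> to
    \<open>t\<close> to \<open>p\<close>.\<close>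
  define g where "g = t \<otimes> y \<otimes> (p \<otimes> t)"
  have g: "g \<in> carrier G" using c by (simp add: g_def)
  have gp: "conjugate g p = y"
    using c pt ty by (simp add: g_def braided_conjugate_mult flip: conjugate_conjugate)
  have "g = t \<otimes> p \<otimes> (y \<otimes> t)"
    using c py unfolding g_def commutes_def by (metis m_assoc m_closed)
  then have gy: "conjugate g y = p"
    using c pt ty by (simp add: braided_conjugate_mult braided_sym flip: conjugate_conjugate)
  have "commutes g v"
    unfolding g_def using c v by (intro commutes_mult) (auto simp: commutes_sym)
  then have "conjugate g v = v" using c g by (simp add: conjugate_fix_iff)
  then have y: "y = v \<otimes> p [^] e"
    using c g p gp gy by (metis conjugate_int_pow conjugate_mult int_pow_closed)
  have "p \<otimes> p [^] e = v \<otimes> y [^] e \<otimes> p [^] e"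
    using p by simp
  also have "\<dots> = v \<otimes> p [^] e \<otimes> y [^] e"
    using c py by (metis commutes_def commutes_int_pow commutes_sym int_pow_closed m_assoc)
  also have "\<dots> = y \<otimes> y [^] e"
    using y by simp
  finally have "p [^] (1 + e) = y [^] (1 + e)"
    using c by (simp add: int_pow_mult)
  then have "commutes (y [^] (1 + e)) t"
    using commutes_if_braided_power[OF c(1-4) pr yr] tr commutes_sym by blast
  then have "commutes (v \<otimes> y [^] (1 + e)) t"
    using c v by (intro commutes_mult) auto
  moreover have "v \<otimes> y [^] (1 + e) = p \<otimes> y"
    using c p by (simp add: add.commute[of 1] int_pow_mult m_assoc[symmetric])
  ultimately show False
    using not_commutes_mult_braided[OF c(1-4) pt py pr ty tr yr] by simp
qed

text \<open>Powers of \<open>y\<close> commute with everything generated by \<open>S\<close>, so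
  they can be collected at the right end of a product.\<close>

lemma generate_insert_commuting:
  assumes S: "S \<subseteq> carrier G" "y \<in> carrier G" "\<And>x. x \<in> S \<Longrightarrow> commutes x y"
    and z: "z \<in> generate G (insert y S)"
  shows "\<exists>v \<in> generate G S. \<exists>e::int. z = v \<otimes> y [^] e"
  using z
proof (induction rule: generate.induct)
  case one
  show ?case by (intro bexI[of _ "\<one>"] exI[of _ 0]) (auto intro: generate.one)
next
  case (incl h)
  then show ?case
  proof
    assume "h = y"
    then show ?thesis using S
      by (intro bexI[of _ "\<one>"] exI[of _ 1]) (auto intro: generate.one)
  next
    assume "h \<in> S"
    then show ?thesis using S
      by (intro bexI[of _ h] exI[of _ 0]) (auto intro: generate.incl)
  qed
next
  case (inv h)
  then show ?case
  proof
    assume "h = y"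
    then show ?thesis using S
      by (intro bexI[of _ "\<one>"] exI[of _ "-1"]) (auto intro: generate.one simp: int_pow_neg)
  next
    assume "h \<in> S"
    then show ?thesis using S
      by (intro bexI[of _ "inv h"] exI[of _ 0]) (auto intro: generate.inv)
  qed
next
  case (eng z z')
  then obtain v e v' e' where v: "v \<in> generate G S" "z = v \<otimes> y [^] (e::int)"
    and v': "v' \<in> generate G S" "z' = v' \<otimes> y [^] (e'::int)" by blast
  have c: "v \<in> carrier G" "v' \<in> carrier G"
    using v v' S generate_in_carrier by auto
  have "commutes v' y"
    using S v'(1) by (rule commutes_generate[of S])
  then have "commutes (y [^] e) v'"
    using c S by (intro commutes_int_pow) (auto simp: commutes_sym)
  then have "y [^] e \<otimes> (v' \<otimes> y [^] e') = v' \<otimes> (y [^] e \<otimes> y [^] e')"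
    using c S unfolding commutes_def by (metis int_pow_closed m_assoc)
  then have "z \<otimes> z' = (v \<otimes> v') \<otimes> y [^] (e + e')"
    using v v' c S by (simp add: int_pow_mult m_assoc)
  then show ?case
    using v v' by (blast intro: generate.eng)
qed

end

section \<open>Band generators\<close>


text \<open>The combinatorial counterpart of the braid relation: for indices in range,
  \<open>band_related\<close> shows that \<open>s t\<close> is braided with \<open>band i j\<close>
  when this holds and commutes with it otherwise.\<close>

definition touches :: "nat \<Rightarrow> nat \<Rightarrow> nat \<Rightarrow> bool" where
  "touches t i j \<longleftrightarrow> (t = i \<or> Suc t = i) \<noteq> (t = j \<or> Suc t = j)"

text \<open>For \<open>n = 4\<close> this fails: complementary pairs of strands are touched alike by every generator.\<close>

lemma touches_separates:
  assumes n: "n = 3 \<or> 5 \<le> (n::nat)"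
    and ij: "1 \<le> i" "i < j" "j \<le> n" and kl: "1 \<le> k" "k < l" "l \<le> n"
    and eq: "\<And>t. 1 \<le> t \<Longrightarrow> t < n \<Longrightarrow> touches t i j \<longleftrightarrow> touches t k l"
  shows "i = k \<and> j = l"
proof -
  \<comment> \<open>\<open>f x\<close> says that \<open>x\<close> lies in the symmetric difference
    of \<open>{i, j}\<close> and \<open>{k, l}\<close>. Touching is a parity count on
    \<open>{t, Suc t}\<close>, so equal touching at \<open>t\<close> means that \<open>f\<close>
    agrees at \<open>t\<close> and \<open>Suc t\<close>.\<close>
  define f where "f x \<longleftrightarrow> (x = i \<or> x = j) \<noteq> (x = k \<or> x = l)" for x
  have step: "f (Suc t) = f t" if "1 \<le> t" "t < n" for t
  proof -
    have "\<not> (t = i \<and> t = j)" "\<not> (t = k \<and> t = l)"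
      "\<not> (Suc t = i \<and> Suc t = j)" "\<not> (Suc t = k \<and> Suc t = l)"
      "\<not> (t = i \<and> Suc t = i)" "\<not> (t = j \<and> Suc t = j)"
      "\<not> (t = k \<and> Suc t = k)" "\<not> (t = l \<and> Suc t = l)"
      using ij(2) kl(2) by auto
    with eq[OF that] show ?thesis unfolding touches_def f_def by argo
  qed
  have const: "f t = f 1" if "1 \<le> t" "t \<le> n" for t
    using that by (induction t rule: dec_induct) (auto simp: step)
  show ?thesis
  proof (cases "f 1")
    case True
    \<comment> \<open>Now every strand lies in exactly one of the two pairs. Four elements cannot
      cover five strands, and two pairs out of three strands share an element.\<close>
    have all: "f 1" "f 2" "f 3" "n \<ge> 5 \<Longrightarrow> f 4" "n \<ge> 5 \<Longrightarrow> f 5"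
      using True const[of 2] const[of 3] const[of 4] const[of 5] n by auto
    show ?thesis
    proof (cases "n = 3")
      case True
      then have "i = 1 \<and> j = 2 \<or> i = 1 \<and> j = 3 \<or> i = 2 \<and> j = 3"
        "k = 1 \<and> l = 2 \<or> k = 1 \<and> l = 3 \<or> k = 2 \<and> l = 3"
        using ij kl by linarith+
      then show ?thesis
        using all(1-3) unfolding f_def by (elim disjE conjE) simp_all
    next
      case False
      have "card {1..5::nat} \<le> card {i, j, k, l}"
      proof (rule card_mono)
        show "{1..5::nat} \<subseteq> {i, j, k, l}"
        proof
          fix x :: nat assume "x \<in> {1..5}"
          then have "f x" using const[of x] True n False by auto
          then show "x \<in> {i, j, k, l}" unfolding f_def by blast
        qed
      qed auto
      also have "card {i, j, k, l} \<le> 4" by (simp add: card_insert_if)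
      finally show ?thesis by simp
    qed
  next
    case False
    then have "\<not> f i" "\<not> f j" "\<not> f k" "\<not> f l"
      using const[of i] const[of j] const[of k] const[of l] ij kl by simp_all
    then show ?thesis using ij(2) kl(2) unfolding f_def by auto
  qed
qed

lemma card_pairs:
  "2 * card {(i, j). a < i \<and> i < j \<and> j \<le> a + m} = m * (m - 1)" for a m :: nat
proof -
  define P where "P m = {(i, j). a < i \<and> i < j \<and> j \<le> a + m}" for m
  have "2 * card (P m) = m * (m - 1)"
  proof (induction m)
    case 0
    have "P 0 = {}" by (auto simp: P_def)
    then show ?case by simp
  next
    case (Suc m)
    have "finite (P m)"
      by (rule finite_subset[of _ "{..a + m} \<times> {..a + m}"]) (auto simp: P_def)
    moreover have "P (Suc m) = P m \<union> {a<..a + m} \<times> {a + Suc m}"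
      by (auto simp: P_def)
    moreover have "P m \<inter> {a<..a + m} \<times> {a + Suc m} = {}"
      by (auto simp: P_def)
    ultimately have "card (P (Suc m)) = card (P m) + m"
      by (simp add: card_Un_disjoint card_cartesian_product)
    then show ?case
      using Suc.IH by (cases m) simp_all
  qed
  then show ?thesis by (simp add: P_def)
qed

section \<open>Counting in finite groups\<close>

context group
begin

text \<open>An orbit-stabilizer bound: \<open>H\<close> fixes \<open>z\<close> under conjugation, so
  \<open>f i \<otimes> h\<close> determines the conjugate of \<open>z\<close> by \<open>f i\<close>,
  hence \<open>i\<close>, and then \<open>h\<close>.\<close>

lemma card_mult_le_by_conjugation:
  assumes fin: "finite (carrier G)" and K: "subgroup K G" and H: "H \<subseteq> K"
    and z: "z \<in> carrier G" and Hz: "\<And>h. h \<in> H \<Longrightarrow> commutes h z"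
    and f: "f \<in> I \<rightarrow> K" and inj: "inj_on (\<lambda>i. conjugate (f i) z) I"
  shows "card I * card H \<le> card K"
proof -
  have KG: "K \<subseteq> carrier G" using K by (rule subgroup.subset)
  have "inj_on (\<lambda>(i, h). f i \<otimes> h) (I \<times> H)"
  proof (rule inj_onI, clarify)
    fix i h i' h'
    assume a: "i \<in> I" "h \<in> H" "i' \<in> I" "h' \<in> H" "f i \<otimes> h = f i' \<otimes> h'"
    have c: "f i \<in> carrier G" "f i' \<in> carrier G" "h \<in> carrier G" "h' \<in> carrier G"
      using a f H KG by auto
    have "conjugate h z = z" "conjugate h' z = z"
      using c z Hz a by (simp_all add: conjugate_fix_iff)
    then have "conjugate (f i) z = conjugate (f i \<otimes> h) z" "conjugate (f i') z = conjugate (f i' \<otimes> h') z"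
      using c z by (simp_all flip: conjugate_conjugate)
    then have "conjugate (f i) z = conjugate (f i') z"
      using a(5) by simp
    then have "i = i'" using inj a by (auto dest: inj_onD)
    then show "i = i' \<and> h = h'" using a c by simp
  qed
  moreover have "(\<lambda>(i, h). f i \<otimes> h) ` (I \<times> H) \<subseteq> K"
    using f H subgroup.m_closed[OF K] by auto
  moreover have "finite K" using KG fin by (rule finite_subset)
  ultimately have "card (I \<times> H) \<le> card K" by (rule card_inj_on_le)
  then show ?thesis by (simp add: card_cartesian_product)
qed

lemma card_double_le:
  assumes fin: "finite (carrier G)" and K: "subgroup K G" and H: "subgroup H G" "H \<subseteq> K"
    and x: "x \<in> K" "x \<notin> H"
  shows "2 * card H \<le> card K"
proof -
  have KG: "K \<subseteq> carrier G" using K by (rule subgroup.subset)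
  have finK: "finite K" using KG fin by (rule finite_subset)
  then have finH: "finite H" using H(2) finite_subset by blast
  have "H \<inter> (\<otimes>) x ` H = {}"
  proof (rule ccontr)
    assume "H \<inter> (\<otimes>) x ` H \<noteq> {}"
    then obtain h where h: "h \<in> H" "x \<otimes> h \<in> H" by auto
    then have "(x \<otimes> h) \<otimes> inv h \<in> H"
      using H(1) by (simp add: subgroup.m_closed subgroup.m_inv_closed)
    then show False
      using h x H KG by (simp add: m_assoc subset_iff)
  qed
  moreover have "card ((\<otimes>) x ` H) = card H"
    using H KG x by (intro card_image inj_onI) (auto simp: subset_iff)
  moreover have "H \<union> (\<otimes>) x ` H \<subseteq> K"
    using H x subgroup.m_closed[OF K] by auto
  ultimately show ?thesis
    using card_mono[OF finK] finH by (metis card_Un_disjoint finite_imageI mult_2)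
qed

lemma generate_subset_if_right_closed:
  assumes S: "S \<subseteq> carrier G" and U: "U \<subseteq> carrier G" "\<one> \<in> U"
    and cl: "\<And>u x. u \<in> U \<Longrightarrow> x \<in> S \<Longrightarrow> u \<otimes> x \<in> U \<and> u \<otimes> inv x \<in> U"
  shows "generate G S \<subseteq> U"
proof -
  \<comment> \<open>Generalized over the starting point \<open>u\<close>, so that the product case
    can apply its two induction hypotheses in succession.\<close>
  have "\<forall>u\<in>U. u \<otimes> z \<in> U" if "z \<in> generate G S" for z
    using that
  proof (induction rule: generate.induct)
    case one
    then show ?case using U by auto
  next
    case (eng x y)
    have "x \<in> carrier G" "y \<in> carrier G"
      using eng.hyps generate_in_carrier[OF S] by auto
    then have "u \<otimes> (x \<otimes> y) = u \<otimes> x \<otimes> y" if "u \<in> U" for u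
      using that U by (auto simp: m_assoc)
    then show ?case using eng.IH by auto
  qed (use cl in auto)
  then have "\<one> \<otimes> z \<in> U" if "z \<in> generate G S" for z
    using that U(2) by blast
  then show ?thesis
    using generate_in_carrier[OF S] by auto
qed

end

section \<open>Images of the standard generators in a group\<close>

locale braid_images = group G for G (structure) +
  fixes n :: nat and s :: "nat \<Rightarrow> 'a"
  assumes gen_closed [simp]: "1 \<le> i \<Longrightarrow> i < n \<Longrightarrow> s i \<in> carrier G"
    and gen_braid: "1 \<le> i \<Longrightarrow> Suc i < n \<Longrightarrow> s i \<otimes> s (Suc i) \<otimes> s i = s (Suc i) \<otimes> s i \<otimes> s (Suc i)"
    and gen_commutes: "1 \<le> i \<Longrightarrow> Suc i < j \<Longrightarrow> j < n \<Longrightarrow> commutes (s i) (s j)"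
begin

lemma gens_subset: "N \<subseteq> {1..<n} \<Longrightarrow> s ` N \<subseteq> carrier G"
  by auto

text \<open>If \<open>s k = s (Suc k)\<close>, then \<open>s (Suc k)\<close> commutes with
  \<open>s (Suc (Suc k))\<close> because \<open>s k\<close> does, and the braid relation makes these
  two equal as well. The equality spreads from \<open>t\<close> in both directions.\<close>

lemma generators_equal:
  assumes t: "1 \<le> t" "Suc t < n" "s t = s (Suc t)" and i: "1 \<le> i" "i < n"
  shows "s i = s 1"
proof -
  have step: "s (Suc k) = s (Suc (Suc k))" if "1 \<le> k" "Suc (Suc k) < n" "s k = s (Suc k)" for k
  proof (rule braided_imp_eq_if_commutes)
    show "commutes (s (Suc k)) (s (Suc (Suc k)))"
      using gen_commutes[of k "Suc (Suc k)"] that by simp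
  qed (use that in \<open>auto intro: gen_braid\<close>)
  have step_down: "s k = s (Suc k)" if "1 \<le> k" "Suc (Suc k) < n" "s (Suc k) = s (Suc (Suc k))" for k
  proof (rule braided_imp_eq_if_commutes)
    show "commutes (s k) (s (Suc k))"
      using gen_commutes[of k "Suc (Suc k)"] that by simp
    show "s k \<otimes> s (Suc k) \<otimes> s k = s (Suc k) \<otimes> s k \<otimes> s (Suc k)"
      using that by (intro gen_braid) auto
  qed (use that in auto)
  have up: "s k = s (Suc k)" if "t \<le> k" "Suc k < n" for k
    using that by (induction k rule: dec_induct) (use t step in auto)
  have down: "s k = s (Suc k)" if "k \<le> t" "1 \<le> k" for k
    using that by (induction k rule: inc_induct) (use t step_down in auto)
  have "s k = s (Suc k)" if "1 \<le> k" "Suc k < n" for k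
    using up[of k] down[of k] that by (cases "t \<le> k") simp_all
  with i show ?thesis
    by (induction i rule: dec_induct) auto
qed

end

text \<open>Instantiated both by a non-cyclic quotient and by the symmetric group itself.\<close>

locale nondegenerate_braid_images = braid_images +
  assumes n: "n = 3 \<or> 5 \<le> n"
    and gen_neq: "1 \<le> i \<Longrightarrow> Suc i < n \<Longrightarrow> s i \<noteq> s (Suc i)"
begin

lemma gen_braided: "1 \<le> i \<Longrightarrow> Suc i < n \<Longrightarrow> braided (s i) (s (Suc i))"
  by (simp add: braided_def gen_braid gen_neq)

text \<open>\<open>link i j\<close> is the product
  \<open>s (j - 1) \<otimes> ... \<otimes> s (i + 1)\<close>, which is empty for
  \<open>j \<le> i + 1\<close>.\<close>

primrec link :: "nat \<Rightarrow> nat \<Rightarrow> 'a" where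
  "link i 0 = \<one>"
| "link i (Suc j) = (if i < j then s j \<otimes> link i j else \<one>)"

text \<open>The band generator usually written \<open>a\<^sub>i\<^sub>j\<close>.\<close>

definition band :: "nat \<Rightarrow> nat \<Rightarrow> 'a" where
  "band i j = conjugate (link i j) (s i)"

lemma link_in_generate:
  assumes "1 \<le> m" "m \<le> i"
  shows "j \<le> n \<Longrightarrow> link i j \<in> generate G (s ` {m..<n})"
  using assms by (induction j) (auto intro!: generate.one intro: generate.eng[OF generate.incl])

lemma link_closed [simp]: "1 \<le> i \<Longrightarrow> j \<le> n \<Longrightarrow> link i j \<in> carrier G"
  by (rule generate_in_carrier[OF gens_subset link_in_generate]) auto

lemma band_closed [simp]: "1 \<le> i \<Longrightarrow> i < j \<Longrightarrow> j \<le> n \<Longrightarrow> band i j \<in> carrier G"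
  by (simp add: band_def)

lemma band_adjacent: "1 \<le> i \<Longrightarrow> i < n \<Longrightarrow> band i (Suc i) = s i"
  by (simp add: band_def)

lemma band_Suc: "1 \<le> i \<Longrightarrow> i < j \<Longrightarrow> j < n \<Longrightarrow> band i (Suc j) = conjugate (s j) (band i j)"
  by (simp add: band_def conjugate_conjugate)

text \<open>Consecutive generators are conjugate by the braid relation. The restriction to indices
  from \<open>m\<close> on puts the conjugator into \<open>level r\<close> when
  \<open>m = Suc (2 * r)\<close>.\<close>

lemma gen_conjugate:
  assumes "1 \<le> m" "m \<le> i" "i < n"
  shows "\<exists>y \<in> generate G (s ` {m..<n}). conjugate y (s m) = s i"
  using assms(2,3)
proof (induction i rule: dec_induct)
  case base
  then show ?case using assms by (intro bexI[of _ \<one>]) (auto intro: generate.one)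
next
  case (step i)
  then obtain y where y: "y \<in> generate G (s ` {m..<n})" "conjugate y (s m) = s i" by auto
  have c: "y \<in> carrier G"
    using y(1) assms by (intro generate_in_carrier[OF gens_subset]) auto
  have "conjugate (s i \<otimes> s (Suc i)) (s i) = s (Suc i)"
    using step assms by (intro braided_conjugate_mult gen_braided) auto
  then have "conjugate (s i \<otimes> s (Suc i) \<otimes> y) (s m) = s (Suc i)"
    using y c step assms by (simp add: conjugate_conjugate[symmetric])
  moreover have "s i \<otimes> s (Suc i) \<otimes> y \<in> generate G (s ` {m..<n})"
    using y step assms by (intro generate.eng) (auto intro!: generate.incl)
  ultimately show ?case by blast
qed

lemma band_conjugate:
  assumes "1 \<le> m" "m \<le> i" "i < j" "j \<le> n"
  shows "\<exists>x \<in> generate G (s ` {m..<n}). conjugate x (s m) = band i j"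
proof -
  obtain y where y: "y \<in> generate G (s ` {m..<n})" "conjugate y (s m) = s i"
    using gen_conjugate[of m i] assms by auto
  have c: "y \<in> carrier G"
    using y(1) assms by (intro generate_in_carrier[OF gens_subset]) auto
  have "conjugate (link i j \<otimes> y) (s m) = band i j"
    using y c assms by (simp add: band_def flip: conjugate_conjugate)
  moreover have "link i j \<otimes> y \<in> generate G (s ` {m..<n})"
    using y(1) link_in_generate[of m i j] assms by (intro generate.eng) auto
  ultimately show ?thesis by blast
qed

text \<open>One predicate for two relations that exclude each other in the group, so that a single
  induction over bands treats both.\<close>

definition related :: "bool \<Rightarrow> 'a \<Rightarrow> 'a \<Rightarrow> bool" where
  "related b x y = (if b then braided x y else commutes x y)"

lemma related_conjugate:
  "g \<in> carrier G \<Longrightarrow> x \<in> carrier G \<Longrightarrow> y \<in> carrier G \<Longrightarrow>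
    related b (conjugate g x) (conjugate g y) \<longleftrightarrow> related b x y"
  by (simp add: related_def)

lemma gen_related:
  assumes "1 \<le> i" "i < n" "1 \<le> t" "t < n"
  shows "related (t = Suc i \<or> i = Suc t) (s i) (s t)"
proof -
  consider "t = Suc i" | "i = Suc t" | "t = i" | "Suc i < t" | "Suc t < i" by linarith
  then show ?thesis
  proof cases
    case 2
    then show ?thesis
      using assms gen_braided[of t] braided_sym by (simp add: related_def)
  next
    case 5
    then show ?thesis
      using assms gen_commutes[of t i] commutes_sym by (simp add: related_def)
  qed (use assms gen_braided gen_commutes in \<open>auto simp: related_def\<close>)
qed

text \<open>Induction on \<open>j\<close>: conjugation by \<open>s j\<close> extends the band. If
  \<open>s t\<close> commutes with \<open>s j\<close>, the relation to \<open>band i j\<close> is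
  preserved; if \<open>s t\<close> commutes with \<open>band i j\<close>, the relation to
  \<open>s j\<close> is inherited. Only \<open>Suc t = j\<close> with \<open>i < t\<close> escapes
  both.\<close>

lemma band_related:
  assumes i: "1 \<le> i" and j: "i < j" "j \<le> n" and t: "1 \<le> t" "t < n"
  shows "related (touches t i j) (band i j) (s t)"
  using j t
proof (induction j arbitrary: t rule: less_induct)
  case (less j')
  then obtain j where j': "j' = Suc j" by (cases j') auto
  show ?case
  proof (cases "i = j")
    case True
    then have "touches t i j' \<longleftrightarrow> t = Suc i \<or> i = Suc t"
      by (auto simp: j' touches_def)
    then show ?thesis
      using gen_related[of i t] less.prems i j' True by (simp add: band_adjacent)
  next
    case False
    then have ij: "i < j" "j < n" using less.prems j' by auto
    have IH: "related (touches u i j) (band i j) (s u)" if "1 \<le> u" "u < n" for u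
      using less.IH[of j u] ij that j' by simp
    have c: "band i j \<in> carrier G" "s j \<in> carrier G" "s t \<in> carrier G"
      using ij i less.prems by auto
    have band: "band i j' = conjugate (s j) (band i j)"
      using ij i by (simp add: j' band_Suc)
    have aj: "braided (band i j) (s j)"
      using IH[of j] ij i by (simp add: related_def touches_def)
    \<comment> \<open>The new band is also the conjugate of \<open>s j\<close> by
      \<open>inv (band i j)\<close>, which fixes \<open>s t\<close>.\<close>
    have *: "related b (band i j') (s t)"
      if "commutes (band i j) (s t)" "related b (s j) (s t)" for b
    proof -
      have "conjugate (inv (band i j)) (s t) = s t"
        using c that by (intro conjugate_fix_iff[THEN iffD2] commutes_inv) auto
      moreover have "band i j' = conjugate (inv (band i j)) (s j)"
        using braided_conjugate_inv[of "s j" "band i j"] c aj by (simp add: band braided_sym)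
      ultimately show ?thesis
        using that c by (metis inv_closed related_conjugate)
    qed
    consider "t = Suc j" | "Suc t = j" "i = t" | "Suc t = j" "i < t" | "Suc j \<noteq> t" "Suc t \<noteq> j"
      using ij by linarith
    then show ?thesis
    proof cases
      case 1
      then show ?thesis
        using *[of True] IH[of t] gen_related[of j t] ij i less.prems
        by (simp add: related_def touches_def j')
    next
      case 2
      then show ?thesis
        using *[of True] IH[of t] gen_related[of j t] ij i less.prems
        by (simp add: related_def touches_def j')
    next
      case 3
      \<comment> \<open>Here \<open>s t\<close> is braided with both \<open>s j\<close> and
        \<open>band i j\<close>. The commuting pair \<open>band i t\<close>, \<open>s j\<close> is
        conjugated by \<open>s j \<otimes> s t\<close> into the required pair.\<close>
      have ct: "band i t \<in> carrier G" using 3 ij i by simp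
      have "related (touches j i t) (band i t) (s j)"
        using less.IH[of t j] 3 ij i j' by simp
      then have "commutes (band i t) (s j)"
        using 3 by (auto simp: related_def touches_def)
      then have "commutes (conjugate (s j \<otimes> s t) (band i t)) (conjugate (s j \<otimes> s t) (s j))"
        using c ct by simp
      moreover have "conjugate (s j \<otimes> s t) (s j) = s t"
        using gen_braided[of t] 3 ij i by (intro braided_conjugate_mult) (auto simp: braided_sym)
      moreover have "conjugate (s j \<otimes> s t) (band i t) = band i j'"
        using c ct band band_Suc[of i t] 3 ij i by (simp add: conjugate_conjugate)
      ultimately show ?thesis
        using 3 by (simp add: related_def touches_def j')
    next
      case 4
      then have "commutes (s j) (s t)"
        using gen_related[of j t] ij i less.prems by (auto simp: related_def)
      then have "conjugate (s j) (s t) = s t"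
        using c by (simp add: conjugate_fix_iff)
      then have "related (touches t i j) (band i j') (s t)"
        using c IH[of t] less.prems related_conjugate[of "s j" "band i j" "s t"] by (simp add: band)
      moreover have "touches t i j' \<longleftrightarrow> touches t i j"
        using 4 ij by (auto simp: touches_def j')
      ultimately show ?thesis by simp
    qed
  qed
qed

lemma band_inject:
  assumes "1 \<le> i" "i < j" "j \<le> n" "1 \<le> k" "k < l" "l \<le> n" "band i j = band k l"
  shows "i = k \<and> j = l"
proof (rule touches_separates[OF n assms(1-6)])
  fix t assume t: "1 \<le> t" "t < n"
  then have "related (touches t i j) (band i j) (s t)" "related (touches t k l) (band i j) (s t)"
    using assms(1-6) band_related[of i j t] band_related[of k l t] by (simp_all add: assms(7))
  then show "touches t i j \<longleftrightarrow> touches t k l"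
    using braided_not_commutes[of "band i j" "s t"] t assms
    by (auto simp: related_def split: if_splits)
qed

end

section \<open>Lower bound for the order\<close>


context nondegenerate_braid_images
begin

text \<open>The level \<open>r\<close> subgroup centralizes the \<open>r\<close> generators \<open>s 1, s 3, \<dots>, s (2 * r - 1)\<close>.\<close>

definition level :: "nat \<Rightarrow> 'a set" where
  "level r = generate G (s ` {i \<in> {1..<n}. 2 * r < i \<or> odd i})"

text \<open>\<open>odds (n div 2)\<close> is the abelian group generated by all odd-indexed
  generators; smaller \<open>j\<close> build it up one generator at a time.\<close>

definition odds :: "nat \<Rightarrow> 'a set" where
  "odds j = generate G (s ` {i \<in> {1..<n}. odd i \<and> i < 2 * j})"

lemma subgroup_level: "subgroup (level r) G"
  unfolding level_def by (intro generate_is_subgroup gens_subset) auto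

lemma subgroup_odds: "subgroup (odds r) G"
  unfolding odds_def by (intro generate_is_subgroup gens_subset) auto

lemma level_0: "level 0 = generate G (s ` {1..<n})"
proof -
  have "{i \<in> {1..<n}. 2 * 0 < i \<or> odd i} = {1..<n}" by auto
  then show ?thesis unfolding level_def by (rule arg_cong)
qed

text \<open>No index below \<open>n\<close> exceeds \<open>2 * (n div 2)\<close>, so only the odd
  indices remain.\<close>

lemma level_half: "level (n div 2) = odds (n div 2)"
proof -
  have "2 * (n div 2) < i \<or> odd i \<longleftrightarrow> odd i \<and> i < 2 * (n div 2)" if "i < n" for i
  proof (cases "even n")
    case True
    then have "2 * (n div 2) = n" by simp
    then show ?thesis using that by simp
  next
    case False
    then have "2 * (n div 2) = n - 1" by simp
    then show ?thesis using that False by (cases "i = n - 1") auto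
  qed
  then have "{i \<in> {1..<n}. 2 * (n div 2) < i \<or> odd i} = {i \<in> {1..<n}. odd i \<and> i < 2 * (n div 2)}"
    by auto
  then show ?thesis unfolding level_def odds_def by (rule arg_cong)
qed

text \<open>Conjugating \<open>s (2 * r + 1)\<close> inside \<open>level r\<close> reaches every
  band on the strands beyond \<open>2 * r\<close>, and these bands are distinct. Since
  \<open>level (Suc r)\<close> commutes with \<open>s (2 * r + 1)\<close>, the orbit bound
  applies.\<close>

lemma card_level_step:
  assumes fin: "finite (carrier G)" and r: "2 * r + 2 \<le> n"
  shows "(n - 2 * r) * (n - 2 * r - 1) * card (level (Suc r)) \<le> 2 * card (level r)"
proof -
  define I where "I = {(i, j). 2 * r < i \<and> i < j \<and> j \<le> n}"
  define z where "z = s (Suc (2 * r))"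
  have z: "z \<in> carrier G" using r by (simp add: z_def)
  have "\<forall>p\<in>I. \<exists>x \<in> level r. conjugate x z = band (fst p) (snd p)"
  proof
    fix p assume "p \<in> I"
    then obtain x where x: "x \<in> generate G (s ` {Suc (2 * r)..<n})"
        "conjugate x z = band (fst p) (snd p)"
      using band_conjugate[of "Suc (2 * r)" "fst p" "snd p"] unfolding I_def z_def by auto
    have "generate G (s ` {Suc (2 * r)..<n}) \<subseteq> level r"
      unfolding level_def by (intro mono_generate image_mono) auto
    with x show "\<exists>x \<in> level r. conjugate x z = band (fst p) (snd p)" by blast
  qed
  then obtain f where f: "\<And>p. p \<in> I \<Longrightarrow> f p \<in> level r"
      "\<And>p. p \<in> I \<Longrightarrow> conjugate (f p) z = band (fst p) (snd p)"
    by metis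
  have "card I * card (level (Suc r)) \<le> card (level r)"
  proof (rule card_mult_le_by_conjugation[OF fin subgroup_level _ z])
    show "level (Suc r) \<subseteq> level r"
      unfolding level_def by (intro mono_generate image_mono) auto
    show "f \<in> I \<rightarrow> level r" using f(1) by blast
    show "inj_on (\<lambda>p. conjugate (f p) z) I"
    proof (rule inj_onI)
      fix p p' assume p: "p \<in> I" "p' \<in> I" "conjugate (f p) z = conjugate (f p') z"
      then have "band (fst p) (snd p) = band (fst p') (snd p')" using f(2) by simp
      then have "fst p = fst p' \<and> snd p = snd p'"
        using p(1,2) unfolding I_def by (intro band_inject) auto
      then show "p = p'" by (simp add: prod_eq_iff)
    qed
    fix h assume "h \<in> level (Suc r)"
    then show "commutes h z"
      unfolding level_def
    proof (rule commutes_generate[rotated 3])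
      fix x assume "x \<in> s ` {i \<in> {1..<n}. 2 * Suc r < i \<or> odd i}"
      then obtain i where i: "x = s i" "1 \<le> i" "i < n" "2 * Suc r < i \<or> odd i" by auto
      \<comment> \<open>Both neighbours of the index \<open>2 * r + 1\<close> are even and at most
        \<open>2 * Suc r\<close>.\<close>
      have "i \<noteq> Suc (Suc (2 * r))" "i \<noteq> 2 * r" using i(4) by auto
      then have "related False (s i) z"
        using gen_related[of i "Suc (2 * r)"] i r unfolding z_def by simp
      then show "commutes x z" by (simp add: related_def i(1))
    qed (use z in auto)
  qed
  moreover have "2 * card I = (n - 2 * r) * (n - 2 * r - 1)"
    using card_pairs[of "2 * r" "n - 2 * r"] r unfolding I_def by simp
  ultimately show ?thesis
    by (metis mult.assoc mult_le_mono2)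
qed

text \<open>The factors \<open>(n - 2 * r) * (n - 2 * r - 1)\<close> of successive steps multiply up
  to a quotient of factorials; the inequality is kept free of division.\<close>

lemma card_level:
  assumes fin: "finite (carrier G)"
  shows "r \<le> n div 2 \<Longrightarrow> fact n * card (level r) \<le> 2 ^ r * fact (n - 2 * r) * card (level 0)"
proof (induction r)
  case (Suc r)
  define m where "m = n - 2 * r"
  have m: "2 \<le> m" "n - 2 * Suc r = m - 2" using Suc.prems by (auto simp: m_def)
  have fm: "fact m = m * (m - 1) * (fact (m - 2) :: nat)"
    using m(1) by (simp add: fact_reduce mult.assoc numeral_2_eq_2)
  have "m * (m - 1) * card (level (Suc r)) \<le> 2 * card (level r)"
    using card_level_step[OF fin, of r] Suc.prems by (simp add: m_def)
  then have "fact n * (m * (m - 1) * card (level (Suc r))) \<le> fact n * (2 * card (level r))"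
    by (rule mult_le_mono2)
  also have "\<dots> = 2 * (fact n * card (level r))"
    by (simp only: mult_ac)
  also have "\<dots> \<le> 2 * (2 ^ r * fact m * card (level 0))"
    using Suc by (intro mult_le_mono2) (simp add: m_def)
  finally have "(m * (m - 1)) * (fact n * card (level (Suc r)))
      \<le> (m * (m - 1)) * (2 ^ Suc r * fact (m - 2) * card (level 0))"
    by (simp add: fm mult_ac)
  then show ?case
    using m by (subst (asm) mult_le_cancel1) simp
qed simp

text \<open>If \<open>s (2 * j + 2)\<close> exists, it commutes with \<open>odds j\<close> but not
  with \<open>s (2 * j + 1)\<close>. When \<open>s (2 * j + 1)\<close> is the last generator this
  witness is missing, and \<open>power_relation_impossible\<close> replaces it.\<close>

lemma next_odd_notin:
  assumes j: "1 \<le> j" "2 * j + 2 \<le> n"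
  shows "s (2 * j + 1) \<notin> odds j"
proof
  assume in_odds: "s (2 * j + 1) \<in> odds j"
  show False
  proof (cases "2 * j + 2 < n")
    case True
    have "commutes (s (2 * j + 1)) (s (2 * j + 2))"
      using in_odds unfolding odds_def
    proof (rule commutes_generate[rotated 3])
      fix x assume "x \<in> s ` {i \<in> {1..<n}. odd i \<and> i < 2 * j}"
      then show "commutes x (s (2 * j + 2))"
        using gen_commutes[of _ "2 * j + 2"] True by auto
    qed (use True in auto)
    then show False
      using braided_not_commutes[OF _ _ gen_braided[of "2 * j + 1"]] True by simp
  next
    case False
    then have n2: "n = 2 * j + 2" using j by simp
    then have "n \<ge> 6" using n by presburger
    \<comment> \<open>The indices \<open>k\<close> to \<open>k + 3\<close> belong to the last four
      generators, a chain of braided neighbours that serve as \<open>r\<close>, \<open>y\<close>,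
      \<open>t\<close>, \<open>p\<close> in \<open>power_relation_impossible\<close>. The generators
      in \<open>S\<close> commute with the last three.\<close>
    define k where "k = 2 * j - 2"
    have k: "2 \<le> k" "n = k + 4" "2 * j = k + 2" using \<open>n \<ge> 6\<close> n2 by (auto simp: k_def)
    define S where "S = s ` {i \<in> {1..<n}. odd i \<and> i < k}"
    have S: "S \<subseteq> carrier G" by (auto simp: S_def)
    have Sc: "commutes x (s i)" if "x \<in> S" "k + 1 \<le> i" "i < n" for x i
      using that gen_commutes[of _ i] by (auto simp: S_def)
    have "i \<in> {1..<n} \<and> odd i \<and> i < 2 * j \<longleftrightarrow> i = k + 1 \<or> i \<in> {1..<n} \<and> odd i \<and> i < k" for i
    proof -
      have "even k" by (simp add: k_def)
      then show ?thesis using k by (cases "i = k"; cases "i = k + 1") auto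
    qed
    then have "{i \<in> {1..<n}. odd i \<and> i < 2 * j} = insert (k + 1) {i \<in> {1..<n}. odd i \<and> i < k}"
      by blast
    then have "s ` {i \<in> {1..<n}. odd i \<and> i < 2 * j} = insert (s (k + 1)) S"
      unfolding S_def by (simp only: image_insert)
    then have "odds j = generate G (insert (s (k + 1)) S)"
      unfolding odds_def by (rule arg_cong)
    moreover have "2 * j + 1 = k + 3" using k(3) by simp
    ultimately have "s (k + 3) \<in> generate G (insert (s (k + 1)) S)"
      using in_odds by metis
    moreover have "s (k + 1) \<in> carrier G" "\<And>x. x \<in> S \<Longrightarrow> commutes x (s (k + 1))"
      using Sc[of _ "k + 1"] k by auto
    ultimately obtain v e where v: "v \<in> generate G S" "s (k + 3) = v \<otimes> s (k + 1) [^] (e::int)"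
      using generate_insert_commuting[OF S] by blast
    have vc: "commutes v (s i)" if "k + 1 \<le> i" "i < n" for i
      using that by (intro commutes_generate[OF S _ _ v(1)] Sc) auto
    have "s (k + 3) \<noteq> v \<otimes> s (k + 1) [^] e"
    proof (rule power_relation_impossible[of _ "s k" "s (k + 2)"])
      show "v \<in> carrier G" using v(1) S generate_in_carrier by blast
      show "braided (s (k + 3)) (s (k + 2))" "braided (s (k + 2)) (s (k + 1))"
          "braided (s (k + 1)) (s k)"
        using gen_braided[of k] gen_braided[of "k + 1"] gen_braided[of "k + 2"] k
        by (simp_all add: braided_sym numeral_eq_Suc)
      show "commutes (s (k + 3)) (s (k + 1))" "commutes (s (k + 3)) (s k)" "commutes (s (k + 2)) (s k)"
        using gen_commutes[of k "k + 2"] gen_commutes[of k "k + 3"] gen_commutes[of "k + 1" "k + 3"] k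
        by (simp_all add: commutes_sym)
      show "commutes v (s (k + 3))" "commutes v (s (k + 2))" "commutes v (s (k + 1))"
        using vc k by simp_all
    qed (use k in simp_all)
    with v(2) show False by simp
  qed
qed

lemma card_odds:
  assumes fin: "finite (carrier G)"
  shows "Suc j \<le> n div 2 \<Longrightarrow> card (odds 1) * 2 ^ j \<le> card (odds (Suc j))"
proof (induction j)
  case (Suc j)
  have "2 * card (odds (Suc j)) \<le> card (odds (Suc (Suc j)))"
  proof (rule card_double_le[OF fin subgroup_odds subgroup_odds])
    show "odds (Suc j) \<subseteq> odds (Suc (Suc j))"
      unfolding odds_def by (intro mono_generate image_mono) auto
    show "s (2 * Suc j + 1) \<notin> odds (Suc j)"
      using Suc.prems by (intro next_odd_notin) auto
    show "s (2 * Suc j + 1) \<in> odds (Suc (Suc j))"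
      unfolding odds_def using Suc.prems by (intro generate.incl imageI) auto
  qed
  then show ?case using Suc by simp
qed simp

lemma gen_1_neq_one: "s 1 \<noteq> \<one>"
proof
  assume "s 1 = \<one>"
  then have "commutes (s 1) (s 2)" using n by auto
  then show False
    using braided_not_commutes[OF _ _ gen_braided[of 1]] n by (auto simp: numeral_2_eq_2)
qed

text \<open>With \<open>card (odds 1)\<close> kept as a factor, one bound serves two ends: this
  factor is at least 2, and at least 3 unless \<open>s 1\<close> is an involution.\<close>

lemma fact_le_card_odds_1:
  assumes fin: "finite (carrier G)"
  shows "fact n * card (odds 1) \<le> 2 * card (generate G (s ` {1..<n}))"
proof -
  define k where "k = n div 2"
  have k: "1 \<le> k" using n by (auto simp: k_def)
  \<comment> \<open>\<open>n - 2 * k\<close> is 0 or 1.\<close>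
  have "fact (n - 2 * k) = (1::nat)"
    by (simp add: k_def minus_mult_div_eq_mod mod_2_eq_odd)
  then have "fact n * card (odds k) \<le> 2 ^ k * card (level 0)"
    using card_level[OF fin, of k] level_half by (simp add: k_def)
  moreover have "card (odds 1) * 2 ^ (k - 1) \<le> card (odds k)"
    using card_odds[OF fin, of "k - 1"] k by (simp add: k_def)
  ultimately have "fact n * (card (odds 1) * 2 ^ (k - 1)) \<le> 2 ^ k * card (level 0)"
    by (meson le_trans mult_le_mono2)
  also have "(2::nat) ^ k = 2 ^ (k - 1) * 2"
    using k by (cases k) simp_all
  finally have "2 ^ (k - 1) * (fact n * card (odds 1)) \<le> 2 ^ (k - 1) * (2 * card (level 0))"
    by (simp only: mult_ac)
  then show ?thesis by (simp add: level_0)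
qed

lemma card_odds_1_ge:
  assumes fin: "finite (carrier G)" and X: "X \<subseteq> {\<one>, s 1, s 1 \<otimes> s 1}"
  shows "card X \<le> card (odds 1)"
proof (rule card_mono)
  have "{i \<in> {1..<n}. odd i \<and> i < 2 * 1} = {1}" using n by auto
  then have "odds 1 = generate G {s 1}" unfolding odds_def by simp
  then show "X \<subseteq> odds 1" using X by (auto intro: generate.intros)
  show "finite (odds 1)"
    using subgroup.subset[OF subgroup_odds] fin by (rule finite_subset)
qed

theorem fact_le_card:
  assumes fin: "finite (carrier G)"
  shows "fact n \<le> card (generate G (s ` {1..<n}))"
proof -
  have "2 \<le> card (odds 1)"
    using card_odds_1_ge[OF fin, of "{\<one>, s 1}"] gen_1_neq_one by auto
  then have "fact n * 2 \<le> fact n * card (odds 1)" by (rule mult_le_mono2)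
  also note fact_le_card_odds_1[OF fin]
  finally show ?thesis by simp
qed

text \<open>If \<open>s 1\<close> did not square to the identity, \<open>odds 1\<close> would have
  at least 3 elements, and \<open>3 * fact n\<close> would be at most \<open>2 * fact n\<close>.
  Every generator is conjugate to \<open>s 1\<close>.\<close>

theorem involution_if_card_le_fact:
  assumes fin: "finite (carrier G)" and card: "card (generate G (s ` {1..<n})) \<le> fact n"
    and i: "1 \<le> i" "i < n"
  shows "s i \<otimes> s i = \<one>"
proof -
  have s1: "s 1 \<in> carrier G" using n by auto
  have "s 1 \<otimes> s 1 = \<one>"
  proof (rule ccontr)
    assume "s 1 \<otimes> s 1 \<noteq> \<one>"
    moreover have "s 1 \<otimes> s 1 \<noteq> s 1" using s1 gen_1_neq_one by simp
    ultimately have "card {\<one>, s 1, s 1 \<otimes> s 1} = 3" using gen_1_neq_one by auto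
    then have "3 \<le> card (odds 1)"
      using card_odds_1_ge[OF fin, of "{\<one>, s 1, s 1 \<otimes> s 1}"] by simp
    then have "fact n * 3 \<le> fact n * card (odds 1)" by (rule mult_le_mono2)
    also note fact_le_card_odds_1[OF fin]
    also have "2 * card (generate G (s ` {1..<n})) \<le> 2 * fact n" using card by simp
    finally have "(fact n :: nat) = 0" by simp
    then show False by simp
  qed
  moreover obtain y where y: "y \<in> generate G (s ` {1..<n})" "conjugate y (s 1) = s i"
    using gen_conjugate[of 1 i] i by auto
  moreover have "y \<in> carrier G" using y(1) by (intro generate_in_carrier[OF gens_subset]) auto
  ultimately show ?thesis
    using s1 conjugate_mult[of y "s 1" "s 1"] by (simp add: conjugate_def)
qed

end

section \<open>The Coxeter bound\<close>


context braid_images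
begin

text \<open>\<open>descent m k\<close> is \<open>s m \<otimes> s (m - 1) \<otimes> \<dots>\<close> with \<open>k\<close> factors; for \<open>k \<le> m\<close> these represent the
  right cosets of the subgroup generated by \<open>s 1, \<dots>, s (m - 1)\<close>, as in the symmetric group.\<close>

primrec descent :: "nat \<Rightarrow> nat \<Rightarrow> 'a" where
  "descent m 0 = \<one>"
| "descent m (Suc k) = descent m k \<otimes> s (m - k)"

lemma descent_closed [simp]: "m < n \<Longrightarrow> k \<le> m \<Longrightarrow> descent m k \<in> carrier G"
  by (induction k) auto

lemma descent_commutes:
  "m < n \<Longrightarrow> 1 \<le> i \<Longrightarrow> i + k < m \<Longrightarrow> commutes (descent m k) (s i)"
proof (induction k)
  case (Suc k)
  then have "commutes (s (m - k)) (s i)"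
    using gen_commutes[of i "m - k"] commutes_sym by auto
  then show ?case using Suc by (auto intro!: commutes_mult)
qed simp

text \<open>The braid relation does the work when the last two factors of the descent are
  \<open>s i\<close> and \<open>s (i - 1)\<close>: the earlier factors commute with
  \<open>s (i - 1)\<close>. Any factors appended later commute with \<open>s i\<close>.\<close>

lemma descent_shift:
  assumes m: "m < n" and i: "i \<le> m"
  shows "k \<le> m \<Longrightarrow> m + 1 < i + k \<Longrightarrow> descent m k \<otimes> s i = s (i - 1) \<otimes> descent m k"
proof (induction k)
  case (Suc k)
  define u where "u = descent m k"
  have u: "u \<in> carrier G" using m Suc.prems by (simp add: u_def)
  have k: "k < m" "1 \<le> k" using Suc.prems i by auto
  show ?case
  proof (cases "m + 1 < i + k")
    case True
    have c: "s (m - k) \<in> carrier G" "s i \<in> carrier G" "s (i - 1) \<in> carrier G"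
      using m i k True by auto
    have "commutes (s (m - k)) (s i)"
      using gen_commutes[of "m - k" i] m i k True by auto
    then have "u \<otimes> s (m - k) \<otimes> s i = u \<otimes> s i \<otimes> s (m - k)"
      using u c by (simp add: m_assoc commutes_def)
    also have "\<dots> = s (i - 1) \<otimes> u \<otimes> s (m - k)"
      using Suc True by (simp add: u_def)
    also have "\<dots> = s (i - 1) \<otimes> (u \<otimes> s (m - k))"
      using u c by (simp add: m_assoc)
    finally show ?thesis by (simp add: u_def)
  next
    case False
    then have ik: "i = m - k + 1" using Suc.prems k by simp
    obtain l where l: "k = Suc l" using k by (cases k) auto
    define w where "w = descent m l"
    have w: "w \<in> carrier G" using m k l by (simp add: w_def)
    have il: "m - l = i" "m - k = i - 1" "1 \<le> i - 1" "i < n" using ik l k m by auto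
    have c: "s i \<in> carrier G" "s (i - 1) \<in> carrier G" using il by auto
    have b: "s (i - 1) \<otimes> s i \<otimes> s (i - 1) = s i \<otimes> s (i - 1) \<otimes> s i"
      using gen_braid[of "i - 1"] il by simp
    have "commutes w (s (i - 1))"
      unfolding w_def using m il l k ik by (intro descent_commutes) auto
    then have cw: "s (i - 1) \<otimes> w = w \<otimes> s (i - 1)" by (simp add: commutes_def)
    have "descent m (Suc k) = w \<otimes> s i \<otimes> s (i - 1)"
      using il by (simp add: l w_def)
    moreover have "w \<otimes> s i \<otimes> s (i - 1) \<otimes> s i = w \<otimes> (s (i - 1) \<otimes> s i \<otimes> s (i - 1))"
      unfolding b using w c by (simp add: m_assoc)
    moreover have "s (i - 1) \<otimes> (w \<otimes> s i \<otimes> s (i - 1)) = s (i - 1) \<otimes> w \<otimes> s i \<otimes> s (i - 1)"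
      using w c by (simp add: m_assoc)
    moreover have "\<dots> = w \<otimes> (s (i - 1) \<otimes> s i \<otimes> s (i - 1))"
      unfolding cw using w c by (simp add: m_assoc)
    ultimately show ?thesis by simp
  qed
qed (use i in simp)

text \<open>The products \<open>h \<otimes> descent m k\<close> with \<open>k \<le> m\<close> are
  closed under right multiplication by the generators, so they exhaust the larger group.\<close>

lemma card_generate_Suc_le:
  assumes inv: "\<And>i. 1 \<le> i \<Longrightarrow> i < n \<Longrightarrow> s i \<otimes> s i = \<one>" and m: "1 \<le> m" "m < n"
    and fin: "finite (generate G (s ` {1..<m}))"
  shows "finite (generate G (s ` {1..<Suc m})) \<and>
    card (generate G (s ` {1..<Suc m})) \<le> Suc m * card (generate G (s ` {1..<m}))"
proof -
  define H where "H = generate G (s ` {1..<m})"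
  define U where "U = (\<lambda>(k, h). h \<otimes> descent m k) ` ({..m} \<times> H)"
  have HG: "H \<subseteq> carrier G"
    unfolding H_def using m by (intro generate_incl gens_subset) auto
  have Hs: "h \<otimes> s i \<in> H" if "h \<in> H" "1 \<le> i" "i < m" for h i
  proof -
    have "s i \<in> H" unfolding H_def using that by (intro generate.incl) auto
    then show ?thesis using that(1) unfolding H_def by (intro generate.eng)
  qed
  have U: "h \<otimes> descent m k \<in> U" if "k \<le> m" "h \<in> H" for h k
    using that unfolding U_def by (auto intro!: image_eqI[of _ _ "(k, h)"])
  have step: "h \<otimes> descent m k \<otimes> s i \<in> U" if k: "k \<le> m" and h: "h \<in> H" and i: "1 \<le> i" "i \<le> m" for h k i
  proof -
    have c: "h \<in> carrier G" "descent m k \<in> carrier G" "s i \<in> carrier G"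
      using k h i m HG by auto
    \<comment> \<open>The generator extends the descent, cancels its last factor, commutes past it,
      or passes it as \<open>s (i - 1)\<close>; in the last two cases it is absorbed into
      \<open>H\<close>.\<close>
    consider "i = m - k" | "i = m - k + 1" | "i + k < m" | "m + 1 < i + k"
      using k by linarith
    then show ?thesis
    proof cases
      case 1
      then have "h \<otimes> descent m k \<otimes> s i = h \<otimes> descent m (Suc k)"
        using c by (simp add: m_assoc)
      then show ?thesis using U[of "Suc k" h] 1 i h by simp
    next
      case 2
      then obtain l where l: "k = Suc l" "m - l = i" using i k by (cases k) auto
      have "descent m l \<in> carrier G" using l k m by simp
      then have "h \<otimes> descent m k \<otimes> s i = h \<otimes> descent m l"
        using c l inv[of i] i m by (simp add: m_assoc)
      then show ?thesis using U[of l h] l k h by simp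
    next
      case 3
      have "commutes (descent m k) (s i)" using 3 i m by (intro descent_commutes)
      then have "h \<otimes> descent m k \<otimes> s i = h \<otimes> s i \<otimes> descent m k"
        using c by (simp add: m_assoc commutes_def)
      then show ?thesis using U[OF k Hs[OF h i(1)]] 3 by simp
    next
      case 4
      have ci: "s (i - 1) \<in> carrier G" using 4 i k m by auto
      have "descent m k \<otimes> s i = s (i - 1) \<otimes> descent m k"
        using 4 i k m by (intro descent_shift)
      then have "h \<otimes> descent m k \<otimes> s i = h \<otimes> s (i - 1) \<otimes> descent m k"
        using c ci by (simp add: m_assoc)
      then show ?thesis using U[OF k Hs[OF h, of "i - 1"]] 4 i k by simp
    qed
  qed
  have "generate G (s ` {1..<Suc m}) \<subseteq> U"
  proof (rule generate_subset_if_right_closed)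
    show "s ` {1..<Suc m} \<subseteq> carrier G" using m by auto
    show "U \<subseteq> carrier G" unfolding U_def using HG m by auto
    show "\<one> \<in> U" using U[of 0 \<one>] by (simp add: H_def generate.one)
    fix u x assume ux: "u \<in> U" "x \<in> s ` {1..<Suc m}"
    then obtain k h i where "u = h \<otimes> descent m k" "k \<le> m" "h \<in> H" "x = s i" "1 \<le> i" "i \<le> m"
      unfolding U_def by auto
    moreover from this have "inv x = x"
      using inv[of i] m by (intro inv_equality) auto
    ultimately show "u \<otimes> x \<in> U \<and> u \<otimes> inv x \<in> U" using step by simp
  qed
  moreover have "finite U" using fin by (simp add: U_def H_def)
  moreover have "card U \<le> Suc m * card H"
    using card_image_le[of "{..m} \<times> H" "\<lambda>(k, h). h \<otimes> descent m k"] fin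
    by (simp add: U_def H_def card_cartesian_product)
  ultimately show ?thesis
    unfolding H_def using card_mono finite_subset by (metis le_trans)
qed

theorem card_generate_involutions_le:
  assumes inv: "\<And>i. 1 \<le> i \<Longrightarrow> i < n \<Longrightarrow> s i \<otimes> s i = \<one>"
  shows "1 \<le> m \<Longrightarrow> m \<le> n \<Longrightarrow>
    finite (generate G (s ` {1..<m})) \<and> card (generate G (s ` {1..<m})) \<le> fact m"
proof (induction m rule: dec_induct)
  case base
  then show ?case by (simp add: generate_empty)
next
  case (step m)
  then have IH: "finite (generate G (s ` {1..<m}))" "card (generate G (s ` {1..<m})) \<le> fact m"
    by auto
  have "card (generate G (s ` {1..<Suc m})) \<le> Suc m * card (generate G (s ` {1..<m}))"
    using card_generate_Suc_le[OF inv _ _ IH(1)] step by simp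
  also have "\<dots> \<le> Suc m * fact m" using IH(2) by (rule mult_le_mono2)
  finally show ?case
    using card_generate_Suc_le[OF inv _ _ IH(1)] step by simp
qed

end

section \<open>The braid group and homomorphisms out of it\<close>

lemma braid_gen_closed: "1 \<le> i \<Longrightarrow> i < n \<Longrightarrow> braid_gen n i \<in> carrier (braid_group n)"
  unfolding braid_gen_def braid_group_def by (intro word_class_in_carrier) auto

lemma braid_images_hom:
  assumes "group H" and h: "h \<in> hom (braid_group n) H"
  shows "braid_images H n (\<lambda>i. h (braid_gen n i))"
proof -
  interpret H: group H by fact
  let ?B = "braid_group n"
  have mult: "h x \<otimes>\<^bsub>H\<^esub> h y = h (x \<otimes>\<^bsub>?B\<^esub> y)" if "x \<in> carrier ?B" "y \<in> carrier ?B" for x y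
    using h that by (simp add: hom_mult)
  define c where "c = word_class {1..<n} (braid_relations n)"
  have gen: "braid_gen n i = c [(i, True)]" for i
    by (simp add: braid_gen_def c_def)
  have class_mult: "c u \<otimes>\<^bsub>?B\<^esub> c v = c (u @ v)"
    if "u \<in> words {1..<n}" "v \<in> words {1..<n}" for u v
    using that unfolding braid_group_def c_def by (rule word_class_mult)
  have rel: "c u = c v"
    if "(u, v) \<in> braid_relations n" "u \<in> words {1..<n}" "v \<in> words {1..<n}" for u v
    using that unfolding c_def by (simp add: word_class_eq_iff word_equiv.relation)
  show ?thesis
  proof
    fix i assume i: "1 \<le> i" "i < n"
    show "h (braid_gen n i) \<in> carrier H"
      using h braid_gen_closed[OF i] by (rule hom_in_carrier)
  next
    fix i assume i: "1 \<le> i" "Suc i < n"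
    have "braid_gen n i \<otimes>\<^bsub>?B\<^esub> braid_gen n (Suc i) \<otimes>\<^bsub>?B\<^esub> braid_gen n i =
        braid_gen n (Suc i) \<otimes>\<^bsub>?B\<^esub> braid_gen n i \<otimes>\<^bsub>?B\<^esub> braid_gen n (Suc i)"
      using i rel[of "[(i, True), (Suc i, True), (i, True)]" "[(Suc i, True), (i, True), (Suc i, True)]"]
      by (simp add: gen class_mult braid_relations_def)
    then show "h (braid_gen n i) \<otimes>\<^bsub>H\<^esub> h (braid_gen n (Suc i)) \<otimes>\<^bsub>H\<^esub> h (braid_gen n i) =
        h (braid_gen n (Suc i)) \<otimes>\<^bsub>H\<^esub> h (braid_gen n i) \<otimes>\<^bsub>H\<^esub> h (braid_gen n (Suc i))"
      using i braid_gen_closed[of _ n] group.is_monoid[OF group_braid_group[of n]]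
      by (simp add: mult monoid.m_closed)
  next
    fix i j assume ij: "1 \<le> i" "Suc i < j" "j < n"
    have "braid_gen n i \<otimes>\<^bsub>?B\<^esub> braid_gen n j = braid_gen n j \<otimes>\<^bsub>?B\<^esub> braid_gen n i"
      using ij rel[of "[(i, True), (j, True)]" "[(j, True), (i, True)]"]
      by (simp add: gen class_mult braid_relations_def)
    then show "H.commutes (h (braid_gen n i)) (h (braid_gen n j))"
      using ij braid_gen_closed[of _ n] by (simp add: H.commutes_def mult)
  qed
qed

lemma generate_braid_gens:
  "generate (braid_group n) (braid_gen n ` {1..<n}) = carrier (braid_group n)"
proof
  interpret B: group "braid_group n" by (rule group_braid_group)
  define c where "c = word_class {1..<n} (braid_relations n)"
  have gen: "braid_gen n i = c [(i, True)]" for i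
    by (simp add: braid_gen_def c_def)
  show "generate (braid_group n) (braid_gen n ` {1..<n}) \<subseteq> carrier (braid_group n)"
    by (intro B.generate_incl) (auto intro: braid_gen_closed)
  have mult: "c u \<otimes>\<^bsub>braid_group n\<^esub> c v = c (u @ v)"
    if "u \<in> words {1..<n}" "v \<in> words {1..<n}" for u v
    using that unfolding braid_group_def c_def by (rule word_class_mult)
  have one: "c [] = \<one>\<^bsub>braid_group n\<^esub>"
    by (simp add: braid_group_def presented_group_def c_def)
  have closed: "c w \<in> carrier (braid_group n)" if "w \<in> words {1..<n}" for w
    using that unfolding braid_group_def c_def by (rule word_class_in_carrier)
  have "c w \<in> generate (braid_group n) (braid_gen n ` {1..<n})" if "w \<in> words {1..<n}" for w
    using that
  proof (induction w)
    case Nil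
    show ?case unfolding one by (rule generate.one)
  next
    case (Cons p w)
    obtain i b where p: "p = (i, b)" by (cases p)
    have i: "i \<in> {1..<n}" using Cons.prems p by simp
    have "c [p] \<in> generate (braid_group n) (braid_gen n ` {1..<n})"
    proof (cases b)
      case True
      then show ?thesis using i p gen by (auto intro!: generate.incl)
    next
      case False
      have "c [(i, False)] \<otimes>\<^bsub>braid_group n\<^esub> braid_gen n i = c [(i, False), (i, True)]"
        using i by (simp add: gen mult)
      also have "\<dots> = c []"
        using word_equiv.cancel[OF i, of _ False] i by (simp add: c_def word_class_eq_iff)
      finally have "inv\<^bsub>braid_group n\<^esub> braid_gen n i = c [(i, False)]"
        using i unfolding one
        by (intro B.inv_equality) (auto simp: braid_gen_closed intro!: closed)
      moreover have "inv\<^bsub>braid_group n\<^esub> braid_gen n i \<in> generate (braid_group n) (braid_gen n ` {1..<n})"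
        using i by (intro generate.inv imageI)
      ultimately show ?thesis using p False by simp
    qed
    moreover have "c (p # w) = c [p] \<otimes>\<^bsub>braid_group n\<^esub> c w"
      using Cons.prems by (simp add: mult)
    ultimately show ?case using Cons by (simp add: generate.eng)
  qed
  then show "carrier (braid_group n) \<subseteq> generate (braid_group n) (braid_gen n ` {1..<n})"
    by (auto simp: braid_group_def presented_group_def c_def)
qed

lemma generate_hom_braid_gens:
  assumes "group H" and h: "h \<in> hom (braid_group n) H"
  shows "generate H ((\<lambda>i. h (braid_gen n i)) ` {1..<n}) = h ` carrier (braid_group n)"
proof -
  interpret group_hom "braid_group n" H h
    using assms group_braid_group by (simp add: group_hom_def group_hom_axioms_def)
  have "generate H (h ` braid_gen n ` {1..<n}) = h ` generate (braid_group n) (braid_gen n ` {1..<n})"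
    by (rule generate_img) (auto intro: braid_gen_closed)
  then show ?thesis unfolding generate_braid_gens image_image .
qed

section \<open>Quotients of order at most \<open>n!\<close>\<close>


lemma nondegenerate_braid_to_sym:
  assumes "n = 3 \<or> 5 \<le> n"
  shows "nondegenerate_braid_images (sym_group n) n (\<lambda>i. braid_to_sym n (braid_gen n i))"
proof -
  interpret braid_images "sym_group n" n "\<lambda>i. braid_to_sym n (braid_gen n i)"
    by (intro braid_images_hom sym_group_is_group braid_to_sym_hom)
  show ?thesis
  proof
    fix i assume i: "1 \<le> i" "Suc i < n"
    have "transpose i (i + 1) \<noteq> transpose (Suc i) (Suc i + 1)"
    proof
      assume "transpose i (i + 1) = transpose (Suc i) (Suc i + 1)"
      from fun_cong[OF this, of i] show False by (simp add: transpose_def)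
    qed
    then show "braid_to_sym n (braid_gen n i) \<noteq> braid_to_sym n (braid_gen n (Suc i))"
      using i braid_to_sym_gen[of i n] braid_to_sym_gen[of "Suc i" n] by auto
  qed fact
qed

lemma finite_sym_group: "finite (carrier (sym_group n))"
  by (simp add: sym_group_def finite_permutations)

text \<open>By counting: the general lower bound, applied inside the symmetric group, shows that the
  image has at least \<open>fact n\<close> elements.\<close>

lemma braid_to_sym_surj:
  assumes "n = 3 \<or> 5 \<le> n"
  shows "braid_to_sym n ` carrier (braid_group n) = carrier (sym_group n)"
proof -
  interpret nondegenerate_braid_images "sym_group n" n "\<lambda>i. braid_to_sym n (braid_gen n i)"
    using assms by (rule nondegenerate_braid_to_sym)
  have "card (carrier (sym_group n)) \<le> card (braid_to_sym n ` carrier (braid_group n))"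
    using fact_le_card[OF finite_sym_group]
    unfolding generate_hom_braid_gens[OF sym_group_is_group braid_to_sym_hom] sym_group_card_carrier .
  moreover have "braid_to_sym n ` carrier (braid_group n) \<subseteq> carrier (sym_group n)"
    using braid_to_sym_hom by (auto simp: hom_def)
  ultimately show ?thesis
    by (intro card_seteq finite_sym_group)
qed

text \<open>Two equal adjacent generators would make all generators equal, and a single element
  would generate the quotient.\<close>

lemma nondegenerate_if_not_cyclic:
  assumes n: "n = 3 \<or> 5 \<le> n" and "group G" and q: "q \<in> epi (braid_group n) G"
    and noncyclic: "\<not> cyclic_group G"
  shows "nondegenerate_braid_images G n (\<lambda>i. q (braid_gen n i))"
proof -
  interpret group G by fact
  have hom: "q \<in> hom (braid_group n) G" using q by (simp add: epi_def)
  interpret braid_images G n "\<lambda>i. q (braid_gen n i)"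
    using \<open>group G\<close> hom by (rule braid_images_hom)
  show ?thesis
  proof
    fix t assume t: "1 \<le> t" "Suc t < n"
    show "q (braid_gen n t) \<noteq> q (braid_gen n (Suc t))"
    proof
      assume eq: "q (braid_gen n t) = q (braid_gen n (Suc t))"
      have "(\<lambda>i. q (braid_gen n i)) ` {1..<n} = (\<lambda>i. q (braid_gen n 1)) ` {1..<n}"
        by (intro image_cong generators_equal[OF t eq]) auto
      also have "\<dots> = {q (braid_gen n 1)}"
        using t by (simp add: image_constant_conv)
      finally have "carrier G = generate G {q (braid_gen n 1)}"
        using generate_hom_braid_gens[OF \<open>group G\<close> hom] q by (simp add: epi_def)
      moreover have "q (braid_gen n 1) \<in> carrier G"
        using t by simp
      ultimately have "cyclic_group G"
        unfolding cyclic_group using generate_pow[of "q (braid_gen n 1)"]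
        by (intro bexI[of _ "q (braid_gen n 1)"]) (simp_all add: full_SetCompr_eq)
      with noncyclic show False by contradiction
    qed
  qed fact
qed

text \<open>The pairs \<open>(\<pi> x, q x)\<close> form a group generated by involutions that satisfy the braid relations,
  so there are at most \<open>n!\<close> of them, and the first projection onto the symmetric group is injective.\<close>

lemma factor_through_sym_group:
  assumes n: "n = 3 \<or> 5 \<le> n" and "group G" and hom: "q \<in> hom (braid_group n) G"
    and inv: "\<And>i. 1 \<le> i \<Longrightarrow> i < n \<Longrightarrow> q (braid_gen n i) \<otimes>\<^bsub>G\<^esub> q (braid_gen n i) = \<one>\<^bsub>G\<^esub>"
    and x: "x \<in> carrier (braid_group n)" "y \<in> carrier (braid_group n)"
    and eq: "braid_to_sym n x = braid_to_sym n y"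
  shows "q x = q y"
proof -
  let ?P = "sym_group n \<times>\<times> G"
  define h where "h x = (braid_to_sym n x, q x)" for x
  have P: "group ?P" using sym_group_is_group \<open>group G\<close> by (rule DirProd_group)
  have h: "h \<in> hom (braid_group n) ?P"
    by (rule homI) (simp_all add: h_def hom_in_carrier[OF braid_to_sym_hom] hom_in_carrier[OF hom]
        hom_mult[OF braid_to_sym_hom] hom_mult[OF hom])
  interpret braid_images ?P n "\<lambda>i. h (braid_gen n i)"
    using P h by (rule braid_images_hom)
  have "h (braid_gen n i) \<otimes>\<^bsub>?P\<^esub> h (braid_gen n i) = \<one>\<^bsub>?P\<^esub>" if "1 \<le> i" "i < n" for i
    using that inv[OF that] by (simp add: h_def braid_to_sym_gen sym_group_mult sym_group_one)
  then have "finite (h ` carrier (braid_group n)) \<and> card (h ` carrier (braid_group n)) \<le> fact n"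
    using card_generate_involutions_le[of n] n generate_hom_braid_gens[OF P h] by auto
  moreover have "fst ` h ` carrier (braid_group n) = carrier (sym_group n)"
    using braid_to_sym_surj[OF n] by (simp add: h_def image_image)
  ultimately have "inj_on fst (h ` carrier (braid_group n))"
    by (metis card_image_le eq_card_imp_inj_on order_antisym sym_group_card_carrier)
  then have "h x = h y"
  proof (rule inj_onD)
    show "fst (h x) = fst (h y)" using eq by (simp add: h_def)
  qed (use x in blast)+
  then show ?thesis by (simp add: h_def)
qed

text \<open>The order bound makes the images of the generators involutions, so \<open>q\<close>
  factors through the symmetric group. The induced map is surjective because \<open>q\<close> is,
  and injective because \<open>G\<close> has at least \<open>fact n\<close> elements.\<close>

lemma small_quotient_iso:
  fixes G (structure)
  assumes n: "n = 3 \<or> 5 \<le> n" and G: "group G" and q: "q \<in> epi (braid_group n) G"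
    and noncyclic: "\<not> cyclic_group G"
    and fin: "finite (carrier G)" and card: "card (carrier G) \<le> fact n"
  shows "\<exists>\<beta> \<in> iso (sym_group n) G. \<forall>x \<in> carrier (braid_group n). q x = \<beta> (braid_to_sym n x)"
proof -
  let ?B = "braid_group n" and ?\<pi> = "braid_to_sym n"
  interpret nondegenerate_braid_images G n "\<lambda>i. q (braid_gen n i)"
    using n G q noncyclic by (rule nondegenerate_if_not_cyclic)
  have hom: "q \<in> hom ?B G" and surj: "q ` carrier ?B = carrier G"
    using q by (simp_all add: epi_def)
  have gen: "generate G ((\<lambda>i. q (braid_gen n i)) ` {1..<n}) = carrier G"
    using generate_hom_braid_gens[OF G hom] surj by simp
  have inv: "q (braid_gen n i) \<otimes> q (braid_gen n i) = \<one>" if "1 \<le> i" "i < n" for i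
    using involution_if_card_le_fact[OF fin _ that] card gen by simp
  \<comment> \<open>\<open>inv_into\<close> picks an arbitrary preimage; by
    \<open>factor_through_sym_group\<close> the value of \<open>q\<close> does not depend on
    it.\<close>
  define \<beta> where "\<beta> p = q (inv_into (carrier ?B) ?\<pi> p)" for p
  have \<beta>: "\<beta> (?\<pi> x) = q x" if "x \<in> carrier ?B" for x
    unfolding \<beta>_def using n G hom inv
  proof (rule factor_through_sym_group)
    show "inv_into (carrier ?B) ?\<pi> (?\<pi> x) \<in> carrier ?B" using that by (intro inv_into_into) auto
    show "?\<pi> (inv_into (carrier ?B) ?\<pi> (?\<pi> x)) = ?\<pi> x" using that by (intro f_inv_into_f) auto
  qed (use that in auto)
  have "\<beta> \<in> hom (sym_group n) G"
  proof (rule homI)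
    fix p assume "p \<in> carrier (sym_group n)"
    then obtain x where x: "x \<in> carrier ?B" "p = ?\<pi> x" using braid_to_sym_surj[OF n] by blast
    then show "\<beta> p \<in> carrier G" using \<beta> surj by auto
    fix p' assume "p' \<in> carrier (sym_group n)"
    then obtain y where y: "y \<in> carrier ?B" "p' = ?\<pi> y" using braid_to_sym_surj[OF n] by blast
    have "x \<otimes>\<^bsub>?B\<^esub> y \<in> carrier ?B"
      using x y group.is_monoid[OF group_braid_group] by (simp add: monoid.m_closed)
    then have "\<beta> (?\<pi> (x \<otimes>\<^bsub>?B\<^esub> y)) = q (x \<otimes>\<^bsub>?B\<^esub> y)" by (rule \<beta>)
    then show "\<beta> (p \<otimes>\<^bsub>sym_group n\<^esub> p') = \<beta> p \<otimes> \<beta> p'"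
      using x y by (simp add: hom_mult[OF braid_to_sym_hom] hom_mult[OF hom] \<beta>)
  qed
  moreover have "\<beta> ` carrier (sym_group n) = carrier G"
    unfolding braid_to_sym_surj[OF n, symmetric] image_image using \<beta> surj by simp
  moreover from this have "inj_on \<beta> (carrier (sym_group n))"
    using fact_le_card[OF fin] card gen
    by (intro eq_card_imp_inj_on finite_sym_group) (simp add: sym_group_card_carrier)
  ultimately have "\<beta> \<in> iso (sym_group n) G"
    by (intro isoI) (simp_all add: bij_betw_def)
  with \<beta> show ?thesis by force
qed

theorem theorem1:
  fixes n :: nat
    and G :: "('a, 'm) monoid_scheme"
    and q :: "nat word set \<Rightarrow> 'a"
  assumes "n = 3 \<or> n \<ge> 5"
    and "group G"
    and "q \<in> epi (braid_group n) G"
    and "\<not> cyclic_group G"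
  shows "(infinite (carrier G) \<or> card (carrier G) > fact n \<or> G \<cong> sym_group n) \<and>
    (\<forall>\<phi> \<in> iso G (sym_group n). \<exists>\<alpha> \<in> iso (sym_group n) (sym_group n).
       \<forall>x \<in> carrier (braid_group n). \<phi> (q x) = \<alpha> (braid_to_sym n x))"
proof (intro conjI ballI)
  note small = small_quotient_iso[OF assms]
  show "infinite (carrier G) \<or> card (carrier G) > fact n \<or> G \<cong> sym_group n"
    using small group.iso_sym[OF sym_group_is_group[of n]] is_isoI by (meson not_less)
  \<comment> \<open>The isomorphism \<open>\<phi>\<close> forces \<open>G\<close> to have order
    \<open>fact n\<close>, so the small case supplies \<open>\<beta>\<close>, and
    \<open>\<phi> \<circ> \<beta>\<close> is the required automorphism.\<close>
  fix \<phi> assume \<phi>: "\<phi> \<in> iso G (sym_group n)"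
  then have bij: "bij_betw \<phi> (carrier G) (carrier (sym_group n))" by (simp add: iso_def)
  then have "finite (carrier G)" using bij_betw_finite finite_sym_group by blast
  moreover have "card (carrier G) \<le> fact n"
    using bij_betw_same_card[OF bij] by (simp add: sym_group_card_carrier)
  ultimately obtain \<beta> where \<beta>: "\<beta> \<in> iso (sym_group n) G"
      "\<forall>x \<in> carrier (braid_group n). q x = \<beta> (braid_to_sym n x)"
    using small by blast
  have "\<phi> \<circ> \<beta> \<in> iso (sym_group n) (sym_group n)"
    using \<beta>(1) \<phi> by (rule iso_set_trans)
  with \<beta>(2) show "\<exists>\<alpha> \<in> iso (sym_group n) (sym_group n).
      \<forall>x \<in> carrier (braid_group n). \<phi> (q x) = \<alpha> (braid_to_sym n x)"
    by (intro bexI[of _ "\<phi> \<circ> \<beta>"]) auto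
qed

end
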